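(* Let $k$ be a field, let $A$ be an infinite set, and let $R=k[x_\alpha:\alpha\in A]$ be the commutative ring of polynomials over $k$ in the infinitely many variables $x_\alpha$, $\alpha\in A$. Let $$0\longrightarrow k\longrightarrow J^0\longrightarrow J^1\longrightarrow J^2\longrightarrow\cdots$$ be an injective coresolution, in the category of $R$-modules, of the one-dimensional $R$-module $k$ on which all the elements $x_\alpha$ act by zero. Let $J$ be an injective $R$-module such that the $R$-module $J^n$ is a direct summand of $J$ for every $n\ge0$. Then the complex $$0\longrightarrow\operatorname{Hom}_R(J,J^0)\longrightarrow\operatorname{Hom}_R(J,J^1)\longrightarrow\operatorname{Hom}_R(J,J^2)\longrightarrow\cdots$$ obtained by applying the functor $\operatorname{Hom}_R(J,-)$ to the truncated coresolution $0\to J^0\to J^1\to J^2\to\cdots$ is a bounded below, noncontractible, acyclic complex of finitely generated projective left modules over the ring $S=\operatorname{Hom}_R(J,J)^{\mathrm{op}}$.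
   Context: Here $S=\operatorname{Hom}_R(J,J)^{\mathrm{op}}$ is the opposite ring of the endomorphism ring of $J$; it acts on $J$ on the right, and for any $R$-module $M$ the abelian group $\operatorname{Hom}_R(J,M)$ is a left $S$-module via precomposition. Complexes are cohomologically graded; bounded below means that the terms vanish in all sufficiently negative degrees. A complex is contractible if its identity endomorphism is homotopic to zero; noncontractible means not contractible (as a complex of left $S$-modules). *)

theory Defs
  imports
    "HOL-Algebra.AbelCoset"
    "HOL-Algebra.Module"
    "HOL-Library.Poly_Mapping"
begin

section \<open>Left modules over a not necessarily commutative ring\<close>

text \<open>The library locale \<^verbatim>\<open>module\<close> requires a commutative ring; the same record
  type is used here for left modules over an arbitrary ring. The record fields
  \<^verbatim>\<open>mult\<close> and \<^verbatim>\<open>one\<close> of the module are irrelevant.\<close>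

locale left_module = R?: ring R + M?: abelian_group M
  for R :: "('r, 'c) ring_scheme" (structure) and M :: "('r, 'm, 'd) module_scheme" (structure) +
  assumes smult_closed [simp, intro]:
      "\<lbrakk>a \<in> carrier R; x \<in> carrier M\<rbrakk> \<Longrightarrow> a \<odot>\<^bsub>M\<^esub> x \<in> carrier M"
    and smult_l_distr:
      "\<lbrakk>a \<in> carrier R; b \<in> carrier R; x \<in> carrier M\<rbrakk> \<Longrightarrow>
        (a \<oplus> b) \<odot>\<^bsub>M\<^esub> x = a \<odot>\<^bsub>M\<^esub> x \<oplus>\<^bsub>M\<^esub> b \<odot>\<^bsub>M\<^esub> x"
    and smult_r_distr:
      "\<lbrakk>a \<in> carrier R; x \<in> carrier M; y \<in> carrier M\<rbrakk> \<Longrightarrow>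
        a \<odot>\<^bsub>M\<^esub> (x \<oplus>\<^bsub>M\<^esub> y) = a \<odot>\<^bsub>M\<^esub> x \<oplus>\<^bsub>M\<^esub> a \<odot>\<^bsub>M\<^esub> y"
    and smult_assoc1:
      "\<lbrakk>a \<in> carrier R; b \<in> carrier R; x \<in> carrier M\<rbrakk> \<Longrightarrow>
        (a \<otimes> b) \<odot>\<^bsub>M\<^esub> x = a \<odot>\<^bsub>M\<^esub> (b \<odot>\<^bsub>M\<^esub> x)"
    and smult_one [simp]:
      "x \<in> carrier M \<Longrightarrow> \<one> \<odot>\<^bsub>M\<^esub> x = x"

lemma module_iff_left_module:
  assumes "cring R"
  shows "module R M \<longleftrightarrow> left_module R M"
  using assms
  by (auto simp: module_def left_module_def module_axioms_def left_module_axioms_def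
      cring.axioms(1))

definition lmod_hom ::
    "('r, 'c) ring_scheme \<Rightarrow> ('r, 'm, 'd) module_scheme \<Rightarrow> ('r, 'n, 'e) module_scheme
      \<Rightarrow> ('m \<Rightarrow> 'n) set" where
  "lmod_hom R M N =
    {f \<in> carrier M \<rightarrow> carrier N.
      (\<forall>x\<in>carrier M. \<forall>y\<in>carrier M. f (x \<oplus>\<^bsub>M\<^esub> y) = f x \<oplus>\<^bsub>N\<^esub> f y) \<and>
      (\<forall>r\<in>carrier R. \<forall>x\<in>carrier M. f (r \<odot>\<^bsub>M\<^esub> x) = r \<odot>\<^bsub>N\<^esub> f x)}"

definition lmod_iso ::
    "('r, 'c) ring_scheme \<Rightarrow> ('r, 'm, 'd) module_scheme \<Rightarrow> ('r, 'n, 'e) module_scheme \<Rightarrow> bool" where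
  "lmod_iso R M N \<longleftrightarrow> (\<exists>f\<in>lmod_hom R M N. bij_betw f (carrier M) (carrier N))"

definition direct_sum_module ::
    "('r, 'm) module \<Rightarrow> ('r, 'n) module \<Rightarrow> ('r, 'm \<times> 'n) module" where
  "direct_sum_module M N =
    \<lparr>carrier = carrier M \<times> carrier N,
     mult = undefined, one = undefined,
     zero = (\<zero>\<^bsub>M\<^esub>, \<zero>\<^bsub>N\<^esub>),
     add = (\<lambda>(x, y) (x', y'). (x \<oplus>\<^bsub>M\<^esub> x', y \<oplus>\<^bsub>N\<^esub> y')),
     smult = (\<lambda>r (x, y). (r \<odot>\<^bsub>M\<^esub> x, r \<odot>\<^bsub>N\<^esub> y))\<rparr>"

text \<open>A complement of a summand of \<open>M\<close> embeds into \<open>M\<close>, so nothing is lost by looking for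
  it in the element type of \<open>M\<close>.\<close>

definition direct_summand ::
    "('r, 'c) ring_scheme \<Rightarrow> ('r, 'n) module \<Rightarrow> ('r, 'm) module \<Rightarrow> bool" where
  "direct_summand R N M \<longleftrightarrow>
    left_module R N \<and> left_module R M \<and>
    (\<exists>K :: ('r, 'm) module. left_module R K \<and> lmod_iso R (direct_sum_module N K) M)"

definition zero_module :: "('r, 'm) module" where
  "zero_module =
    \<lparr>carrier = {undefined}, mult = undefined, one = undefined, zero = undefined,
     add = (\<lambda>_ _. undefined), smult = (\<lambda>_ _. undefined)\<rparr>"

definition finitely_generated ::
    "('r, 'c) ring_scheme \<Rightarrow> ('r, 'm) module \<Rightarrow> bool" where
  "finitely_generated R M \<longleftrightarrow>
    (\<exists>G. finite G \<and> G \<subseteq> carrier M \<and>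
      (\<forall>x\<in>carrier M. \<exists>c\<in>G \<rightarrow> carrier R. x = (\<Oplus>\<^bsub>M\<^esub>g\<in>G. c g \<odot>\<^bsub>M\<^esub> g)))"


section \<open>Projective and injective modules\<close>

text \<open>HOL cannot quantify over types inside a definition, so the lifting and extension
  properties are stated for test modules \<open>X\<close>, \<open>Y\<close> with elements in a type \<open>'u\<close> passed as a
  parameter. A pair of test modules with different element types can be moved to a
  common one. A projectivity claim with a free type variable \<open>'u\<close> in the conclusion
  of a theorem says that the module has the lifting property against all modules.\<close>

definition projective_over ::
    "'u itself \<Rightarrow> ('r, 'c) ring_scheme \<Rightarrow> ('r, 'm) module \<Rightarrow> bool" where
  "projective_over (U :: 'u itself) R P \<longleftrightarrow>
    left_module R P \<and>
    (\<forall>(X :: ('r, 'u) module) (Y :: ('r, 'u) module) p f.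
      left_module R X \<and> left_module R Y \<and>
      p \<in> lmod_hom R X Y \<and> p ` carrier X = carrier Y \<and> f \<in> lmod_hom R P Y \<longrightarrow>
      (\<exists>g\<in>lmod_hom R P X. \<forall>x\<in>carrier P. p (g x) = f x))"

definition injective_over ::
    "'u itself \<Rightarrow> ('r, 'c) ring_scheme \<Rightarrow> ('r, 'm) module \<Rightarrow> bool" where
  "injective_over (U :: 'u itself) R J \<longleftrightarrow>
    left_module R J \<and>
    (\<forall>(X :: ('r, 'u) module) (Y :: ('r, 'u) module) i f.
      left_module R X \<and> left_module R Y \<and>
      i \<in> lmod_hom R X Y \<and> inj_on i (carrier X) \<and> f \<in> lmod_hom R X J \<longrightarrow>
      (\<exists>g\<in>lmod_hom R Y J. \<forall>x\<in>carrier X. g (i x) = f x))"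

text \<open>Injectivity occurs as a hypothesis, so a fixed universe of test modules is needed. The
  element type of \<open>R\<close> suffices: by Baer's criterion (theorem \<^verbatim>\<open>injective_module_extends\<close>
  below) the extension property then holds for monomorphisms between modules of
  arbitrary types.\<close>

definition injective_module ::
    "('r, 'c) ring_scheme \<Rightarrow> ('r, 'm) module \<Rightarrow> bool" where
  "injective_module R J \<longleftrightarrow> injective_over TYPE('r) R J"

lemma lmod_homD:
  assumes "f \<in> lmod_hom R M N"
  shows "x \<in> carrier M \<Longrightarrow> f x \<in> carrier N"
    and "\<lbrakk>x \<in> carrier M; y \<in> carrier M\<rbrakk> \<Longrightarrow> f (x \<oplus>\<^bsub>M\<^esub> y) = f x \<oplus>\<^bsub>N\<^esub> f y"
    and "\<lbrakk>r \<in> carrier R; x \<in> carrier M\<rbrakk> \<Longrightarrow> f (r \<odot>\<^bsub>M\<^esub> x) = r \<odot>\<^bsub>N\<^esub> f x"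
  using assms by (auto simp: lmod_hom_def)

lemma (in left_module) smult_zero [simp]:
  assumes "a \<in> carrier R" shows "a \<odot>\<^bsub>M\<^esub> \<zero>\<^bsub>M\<^esub> = \<zero>\<^bsub>M\<^esub>"
proof -
  have "a \<odot>\<^bsub>M\<^esub> \<zero>\<^bsub>M\<^esub> \<oplus>\<^bsub>M\<^esub> a \<odot>\<^bsub>M\<^esub> \<zero>\<^bsub>M\<^esub> = a \<odot>\<^bsub>M\<^esub> \<zero>\<^bsub>M\<^esub>"
    using assms smult_r_distr[of a "\<zero>\<^bsub>M\<^esub>" "\<zero>\<^bsub>M\<^esub>"] by simp
  then show ?thesis using assms by (metis M.add.l_cancel_one' M.zero_closed smult_closed)
qed

lemma (in left_module) zero_smult [simp]:
  assumes "x \<in> carrier M" shows "\<zero> \<odot>\<^bsub>M\<^esub> x = \<zero>\<^bsub>M\<^esub>"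
proof -
  have "\<zero> \<odot>\<^bsub>M\<^esub> x \<oplus>\<^bsub>M\<^esub> \<zero> \<odot>\<^bsub>M\<^esub> x = \<zero> \<odot>\<^bsub>M\<^esub> x"
    using assms smult_l_distr[of "\<zero>" "\<zero>" x] by simp
  then show ?thesis using assms by (metis M.add.l_cancel_one' R.zero_closed smult_closed)
qed

lemma (in left_module) minus_smult:
  assumes "x \<in> carrier M" shows "(\<ominus> \<one>) \<odot>\<^bsub>M\<^esub> x = \<ominus>\<^bsub>M\<^esub> x"
proof -
  have "(\<ominus> \<one>) \<odot>\<^bsub>M\<^esub> x \<oplus>\<^bsub>M\<^esub> x = \<zero>\<^bsub>M\<^esub>"
    using assms smult_l_distr[of "\<ominus> \<one>" "\<one>" x] by (simp add: R.l_neg)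
  then show ?thesis using assms by (simp add: M.minus_equality)
qed

lemma lmod_hom_zero:
  assumes "f \<in> lmod_hom R M N" "left_module R M" "left_module R N"
  shows "f \<zero>\<^bsub>M\<^esub> = \<zero>\<^bsub>N\<^esub>"
proof -
  interpret M: left_module R M by fact
  interpret N: left_module R N by fact
  have "f (\<zero>\<^bsub>R\<^esub> \<odot>\<^bsub>M\<^esub> \<zero>\<^bsub>M\<^esub>) = \<zero>\<^bsub>R\<^esub> \<odot>\<^bsub>N\<^esub> f \<zero>\<^bsub>M\<^esub>"
    using lmod_homD(3)[OF assms(1)] by blast
  then show ?thesis using lmod_homD(1)[OF assms(1)] by simp
qed

text \<open>Graphs of partial homomorphisms from \<open>Y\<close> to \<open>J\<close>.\<close>

definition partial_graph ::
    "('r, 'c) ring_scheme \<Rightarrow> ('r, 'n) module \<Rightarrow> ('r, 'm) module \<Rightarrow> ('n \<times> 'm) set \<Rightarrow> bool" where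
  "partial_graph R Y J G \<longleftrightarrow>
    G \<subseteq> carrier Y \<times> carrier J \<and>
    (\<forall>y z y' z'. (y, z) \<in> G \<longrightarrow> (y', z') \<in> G \<longrightarrow> (y \<oplus>\<^bsub>Y\<^esub> y', z \<oplus>\<^bsub>J\<^esub> z') \<in> G) \<and>
    (\<forall>r y z. r \<in> carrier R \<longrightarrow> (y, z) \<in> G \<longrightarrow> (r \<odot>\<^bsub>Y\<^esub> y, r \<odot>\<^bsub>J\<^esub> z) \<in> G) \<and>
    (\<forall>z. (\<zero>\<^bsub>Y\<^esub>, z) \<in> G \<longrightarrow> z = \<zero>\<^bsub>J\<^esub>)"

lemma partial_graph_unique:
  assumes "partial_graph R Y J G" "left_module R Y" "left_module R J"
    and yz: "(y, z) \<in> G" and yz': "(y, z') \<in> G"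
  shows "z = z'"
proof -
  interpret Y: left_module R Y by fact
  interpret J: left_module R J by fact
  have G: "y \<in> carrier Y" "z \<in> carrier J" "z' \<in> carrier J"
    using assms unfolding partial_graph_def by auto
  have "((\<ominus>\<^bsub>R\<^esub> \<one>\<^bsub>R\<^esub>) \<odot>\<^bsub>Y\<^esub> y, (\<ominus>\<^bsub>R\<^esub> \<one>\<^bsub>R\<^esub>) \<odot>\<^bsub>J\<^esub> z') \<in> G"
    using assms(1) yz' unfolding partial_graph_def by (meson Y.R.a_inv_closed Y.R.one_closed)
  then have "(y \<oplus>\<^bsub>Y\<^esub> (\<ominus>\<^bsub>R\<^esub> \<one>\<^bsub>R\<^esub>) \<odot>\<^bsub>Y\<^esub> y, z \<oplus>\<^bsub>J\<^esub> (\<ominus>\<^bsub>R\<^esub> \<one>\<^bsub>R\<^esub>) \<odot>\<^bsub>J\<^esub> z') \<in> G"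
    using assms(1) yz unfolding partial_graph_def by blast
  then have "(\<zero>\<^bsub>Y\<^esub>, z \<oplus>\<^bsub>J\<^esub> \<ominus>\<^bsub>J\<^esub> z') \<in> G"
    using G by (simp add: Y.minus_smult J.minus_smult Y.M.r_neg)
  then have "z \<oplus>\<^bsub>J\<^esub> \<ominus>\<^bsub>J\<^esub> z' = \<zero>\<^bsub>J\<^esub>"
    using assms(1) unfolding partial_graph_def by blast
  then show ?thesis
    using G by (metis J.M.add.inv_closed J.M.minus_equality J.M.minus_minus)
qed

lemma partial_graph_step:
  fixes R :: "('r, 'c) ring_scheme" and Y :: "('r, 'u) module" and J :: "('r, 'm) module"
  assumes inj: "injective_module R J" and Y: "left_module R Y"
    and G: "partial_graph R Y J G" and "G \<noteq> {}" and y: "y \<in> carrier Y"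
  shows "\<exists>G'. partial_graph R Y J G' \<and> G \<subseteq> G' \<and> y \<in> fst ` G'"
proof -
  interpret Y: left_module R Y by fact
  interpret J: left_module R J
    using inj unfolding injective_module_def injective_over_def by blast
  have lJ: "left_module R J" by (rule J.left_module_axioms)
  have Gsub: "\<And>u z. (u, z) \<in> G \<Longrightarrow> u \<in> carrier Y \<and> z \<in> carrier J"
    and Gadd: "\<And>u z u' z'. (u, z) \<in> G \<Longrightarrow> (u', z') \<in> G \<Longrightarrow> (u \<oplus>\<^bsub>Y\<^esub> u', z \<oplus>\<^bsub>J\<^esub> z') \<in> G"
    and Gsm: "\<And>r u z. r \<in> carrier R \<Longrightarrow> (u, z) \<in> G \<Longrightarrow> (r \<odot>\<^bsub>Y\<^esub> u, r \<odot>\<^bsub>J\<^esub> z) \<in> G"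
    using G unfolding partial_graph_def by blast+
  have Gun: "\<And>u z z'. (u, z) \<in> G \<Longrightarrow> (u, z') \<in> G \<Longrightarrow> z = z'"
    using partial_graph_unique[OF G Y lJ] by blast
  obtain u0 z0 where "(u0, z0) \<in> G" using \<open>G \<noteq> {}\<close> by auto
  then have G0: "(\<zero>\<^bsub>Y\<^esub>, \<zero>\<^bsub>J\<^esub>) \<in> G"
    using Gsm[of "\<zero>\<^bsub>R\<^esub>" u0 z0] Gsub by auto
  define A where "A = {r \<in> carrier R. \<exists>z. (r \<odot>\<^bsub>Y\<^esub> y, z) \<in> G}"
  define \<phi> where "\<phi> = (\<lambda>r. THE z. (r \<odot>\<^bsub>Y\<^esub> y, z) \<in> G)"
  have \<phi>: "\<phi> r = z" if "(r \<odot>\<^bsub>Y\<^esub> y, z) \<in> G" for r z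
    unfolding \<phi>_def using that Gun by (intro the_equality) auto
  define RR :: "('r, 'r) module" where
    "RR = \<lparr>carrier = carrier R, mult = undefined, one = undefined, zero = \<zero>\<^bsub>R\<^esub>,
      add = add R, smult = mult R\<rparr>"
  define AA where "AA = RR\<lparr>carrier := A\<rparr>"
  have lRR: "left_module R RR"
  proof unfold_locales
    show "carrier (add_monoid RR) \<subseteq> Units (add_monoid RR)"
      unfolding Units_def RR_def
      by (auto intro!: bexI[where x = "\<ominus>\<^bsub>R\<^esub> _"] simp: Y.R.l_neg Y.R.r_neg)
  qed (auto simp: RR_def Y.R.a_ac Y.R.l_distr Y.R.r_distr Y.R.m_assoc)
  have A0: "\<zero>\<^bsub>R\<^esub> \<in> A" using G0 y by (auto simp: A_def)
  have Aadd: "r \<oplus>\<^bsub>R\<^esub> s \<in> A" "\<phi> (r \<oplus>\<^bsub>R\<^esub> s) = \<phi> r \<oplus>\<^bsub>J\<^esub> \<phi> s" if rs: "r \<in> A" "s \<in> A" for r s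
  proof -
    obtain z w where zw: "(r \<odot>\<^bsub>Y\<^esub> y, z) \<in> G" "(s \<odot>\<^bsub>Y\<^esub> y, w) \<in> G" "r \<in> carrier R" "s \<in> carrier R"
      using rs by (auto simp: A_def)
    then have "((r \<oplus>\<^bsub>R\<^esub> s) \<odot>\<^bsub>Y\<^esub> y, z \<oplus>\<^bsub>J\<^esub> w) \<in> G"
      using Gadd[OF zw(1,2)] y by (simp add: Y.smult_l_distr)
    then show "r \<oplus>\<^bsub>R\<^esub> s \<in> A" "\<phi> (r \<oplus>\<^bsub>R\<^esub> s) = \<phi> r \<oplus>\<^bsub>J\<^esub> \<phi> s"
      using zw \<phi> by (auto simp: A_def)
  qed
  have Asm: "r \<otimes>\<^bsub>R\<^esub> s \<in> A" "\<phi> (r \<otimes>\<^bsub>R\<^esub> s) = r \<odot>\<^bsub>J\<^esub> \<phi> s" if rs: "r \<in> carrier R" "s \<in> A" for r s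
  proof -
    obtain w where w: "(s \<odot>\<^bsub>Y\<^esub> y, w) \<in> G" "s \<in> carrier R"
      using rs by (auto simp: A_def)
    then have "((r \<otimes>\<^bsub>R\<^esub> s) \<odot>\<^bsub>Y\<^esub> y, r \<odot>\<^bsub>J\<^esub> w) \<in> G"
      using Gsm[OF rs(1) w(1)] y rs by (simp add: Y.smult_assoc1)
    then show "r \<otimes>\<^bsub>R\<^esub> s \<in> A" "\<phi> (r \<otimes>\<^bsub>R\<^esub> s) = r \<odot>\<^bsub>J\<^esub> \<phi> s"
      using w \<phi> rs by (auto simp: A_def)
  qed
  have Ainv: "\<ominus>\<^bsub>R\<^esub> r \<in> A" if "r \<in> A" for r
    using Asm(1)[of "\<ominus>\<^bsub>R\<^esub> \<one>\<^bsub>R\<^esub>" r] that by (simp add: Y.R.l_minus A_def)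
  have AR: "r \<in> carrier R" if "r \<in> A" for r using that by (simp add: A_def)
  have lAA: "left_module R AA"
  proof unfold_locales
    show "carrier (add_monoid AA) \<subseteq> Units (add_monoid AA)"
    proof
      fix r assume "r \<in> carrier (add_monoid AA)"
      then have "r \<in> A" by (simp add: AA_def)
      then show "r \<in> Units (add_monoid AA)"
        using Ainv[of r] AR[of r] unfolding Units_def AA_def RR_def
        by (auto intro!: bexI[of _ "\<ominus>\<^bsub>R\<^esub> r"] simp: Y.R.l_neg Y.R.r_neg)
    qed
  qed (auto simp: AA_def RR_def Y.R.a_ac Y.R.l_distr Y.R.r_distr Y.R.m_assoc
      A0 Aadd Asm AR)
  have "\<phi> r \<in> carrier J" if "r \<in> A" for r
    using that \<phi> Gsub by (auto simp: A_def)
  then have "\<phi> \<in> lmod_hom R AA J"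
    by (auto simp: lmod_hom_def AA_def RR_def Aadd Asm)
  moreover have "(\<lambda>r. r) \<in> lmod_hom R AA RR"
    by (auto simp: lmod_hom_def AA_def RR_def AR)
  ultimately obtain g where g: "g \<in> lmod_hom R RR J" and g\<phi>: "\<forall>r\<in>carrier AA. g r = \<phi> r"
    using inj lAA lRR unfolding injective_module_def injective_over_def
    by (metis inj_on_def)
  define e where "e = g \<one>\<^bsub>R\<^esub>"
  have e: "e \<in> carrier J" using lmod_homD(1)[OF g] by (simp add: e_def RR_def)
  have ge: "g r = r \<odot>\<^bsub>J\<^esub> e" if "r \<in> carrier R" for r
    using lmod_homD(3)[OF g, of r "\<one>\<^bsub>R\<^esub>"] that by (simp add: e_def RR_def)
  define G' where "G' = {(u \<oplus>\<^bsub>Y\<^esub> r \<odot>\<^bsub>Y\<^esub> y, z \<oplus>\<^bsub>J\<^esub> r \<odot>\<^bsub>J\<^esub> e) |u z r. (u, z) \<in> G \<and> r \<in> carrier R}"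
  have G'I: "\<lbrakk>(u, z) \<in> G; r \<in> carrier R; a = u \<oplus>\<^bsub>Y\<^esub> r \<odot>\<^bsub>Y\<^esub> y; b = z \<oplus>\<^bsub>J\<^esub> r \<odot>\<^bsub>J\<^esub> e\<rbrakk>
      \<Longrightarrow> (a, b) \<in> G'" for u z r a b
    unfolding G'_def by blast
  have "partial_graph R Y J G'"
    unfolding partial_graph_def
  proof (intro conjI allI impI)
    show "G' \<subseteq> carrier Y \<times> carrier J" using Gsub y e by (auto simp: G'_def)
  next
    fix a b a' b' assume "(a, b) \<in> G'" "(a', b') \<in> G'"
    then obtain u z r u' z' r' where *: "(u, z) \<in> G" "r \<in> carrier R" "a = u \<oplus>\<^bsub>Y\<^esub> r \<odot>\<^bsub>Y\<^esub> y"
        "b = z \<oplus>\<^bsub>J\<^esub> r \<odot>\<^bsub>J\<^esub> e" "(u', z') \<in> G" "r' \<in> carrier R" "a' = u' \<oplus>\<^bsub>Y\<^esub> r' \<odot>\<^bsub>Y\<^esub> y"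
        "b' = z' \<oplus>\<^bsub>J\<^esub> r' \<odot>\<^bsub>J\<^esub> e"
      unfolding G'_def by blast
    show "(a \<oplus>\<^bsub>Y\<^esub> a', b \<oplus>\<^bsub>J\<^esub> b') \<in> G'"
      by (rule G'I[OF Gadd[OF *(1) *(5)], of "r \<oplus>\<^bsub>R\<^esub> r'"])
        (use * Gsub[OF *(1)] Gsub[OF *(5)] y e in
          \<open>simp_all add: Y.smult_l_distr J.smult_l_distr Y.M.a_ac J.M.a_ac\<close>)
  next
    fix s a b assume s: "s \<in> carrier R" and "(a, b) \<in> G'"
    then obtain u z r where *: "(u, z) \<in> G" "r \<in> carrier R" "a = u \<oplus>\<^bsub>Y\<^esub> r \<odot>\<^bsub>Y\<^esub> y"
        "b = z \<oplus>\<^bsub>J\<^esub> r \<odot>\<^bsub>J\<^esub> e"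
      unfolding G'_def by blast
    show "(s \<odot>\<^bsub>Y\<^esub> a, s \<odot>\<^bsub>J\<^esub> b) \<in> G'"
      by (rule G'I[OF Gsm[OF s *(1)], of "s \<otimes>\<^bsub>R\<^esub> r"])
        (use s * Gsub[OF *(1)] y e in
          \<open>simp_all add: Y.smult_r_distr J.smult_r_distr Y.smult_assoc1 J.smult_assoc1\<close>)
  next
    fix b assume "(\<zero>\<^bsub>Y\<^esub>, b) \<in> G'"
    then obtain u z r where *: "(u, z) \<in> G" "r \<in> carrier R" "\<zero>\<^bsub>Y\<^esub> = u \<oplus>\<^bsub>Y\<^esub> r \<odot>\<^bsub>Y\<^esub> y"
        "b = z \<oplus>\<^bsub>J\<^esub> r \<odot>\<^bsub>J\<^esub> e"
      unfolding G'_def by blast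
    have c: "u \<in> carrier Y" "z \<in> carrier J" using Gsub[OF *(1)] by auto
    have "((\<ominus>\<^bsub>R\<^esub> \<one>\<^bsub>R\<^esub>) \<odot>\<^bsub>Y\<^esub> u, (\<ominus>\<^bsub>R\<^esub> \<one>\<^bsub>R\<^esub>) \<odot>\<^bsub>J\<^esub> z) \<in> G" by (rule Gsm) (auto simp: *)
    then have "(\<ominus>\<^bsub>Y\<^esub> u, \<ominus>\<^bsub>J\<^esub> z) \<in> G" using c by (simp add: Y.minus_smult J.minus_smult)
    moreover have "\<ominus>\<^bsub>Y\<^esub> u = r \<odot>\<^bsub>Y\<^esub> y"
      using * c y by (metis Y.M.a_comm Y.M.minus_equality Y.smult_closed)
    ultimately have "(r \<odot>\<^bsub>Y\<^esub> y, \<ominus>\<^bsub>J\<^esub> z) \<in> G" by simp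
    then have "\<phi> r = \<ominus>\<^bsub>J\<^esub> z" "r \<in> A" using \<phi> * by (auto simp: A_def)
    then have "r \<odot>\<^bsub>J\<^esub> e = \<ominus>\<^bsub>J\<^esub> z" using g\<phi> ge[OF *(2)] by (simp add: AA_def)
    then show "b = \<zero>\<^bsub>J\<^esub>" using * c by (simp add: J.M.r_neg)
  qed
  moreover have "G \<subseteq> G'"
  proof
    fix p assume "p \<in> G"
    then obtain u z where p: "p = (u, z)" "(u, z) \<in> G" by (cases p) auto
    show "p \<in> G'" unfolding p(1)
      by (rule G'I[OF p(2), of "\<zero>\<^bsub>R\<^esub>"]) (use Gsub[OF p(2)] y e in simp_all)
  qed
  moreover have "(y, e) \<in> G'"
    by (rule G'I[OF G0, of "\<one>\<^bsub>R\<^esub>"]) (use y e in simp_all)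
  ultimately show ?thesis by force
qed

theorem injective_module_extends:
  fixes R :: "('r, 'c) ring_scheme" and J :: "('r, 'm) module"
    and X :: "('r, 'u) module" and Y :: "('r, 'v) module"
  assumes inj: "injective_module R J" and X: "left_module R X" and Y: "left_module R Y"
    and i: "i \<in> lmod_hom R X Y" and inji: "inj_on i (carrier X)" and f: "f \<in> lmod_hom R X J"
  shows "\<exists>g\<in>lmod_hom R Y J. \<forall>x\<in>carrier X. g (i x) = f x"
proof -
  interpret X: left_module R X by fact
  interpret Y: left_module R Y by fact
  interpret J: left_module R J
    using inj unfolding injective_module_def injective_over_def by blast
  have lJ: "left_module R J" by (rule J.left_module_axioms)
  note iD = lmod_homD[OF i] and fD = lmod_homD[OF f]
  define B where "B = (\<lambda>x. (i x, f x)) ` carrier X"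
  have BI: "\<lbrakk>x \<in> carrier X; a = i x; b = f x\<rbrakk> \<Longrightarrow> (a, b) \<in> B" for x a b
    unfolding B_def by blast
  have B: "partial_graph R Y J B"
    unfolding partial_graph_def
  proof (intro conjI allI impI)
    show "B \<subseteq> carrier Y \<times> carrier J" by (auto simp: B_def iD fD)
  next
    fix a b a' b' assume "(a, b) \<in> B" "(a', b') \<in> B"
    then show "(a \<oplus>\<^bsub>Y\<^esub> a', b \<oplus>\<^bsub>J\<^esub> b') \<in> B"
      unfolding B_def by (force simp: iD fD intro: image_eqI[OF _ X.M.a_closed])
  next
    fix r a b assume "r \<in> carrier R" "(a, b) \<in> B"
    then show "(r \<odot>\<^bsub>Y\<^esub> a, r \<odot>\<^bsub>J\<^esub> b) \<in> B"
      unfolding B_def by (force simp: iD fD intro: image_eqI[OF _ X.smult_closed])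
  next
    fix b assume "(\<zero>\<^bsub>Y\<^esub>, b) \<in> B"
    then obtain x where x: "x \<in> carrier X" "i x = \<zero>\<^bsub>Y\<^esub>" "b = f x" by (auto simp: B_def)
    have "x = \<zero>\<^bsub>X\<^esub>"
      using inj_onD[OF inji, of x "\<zero>\<^bsub>X\<^esub>"] x lmod_hom_zero[OF i X Y] by auto
    then show "b = \<zero>\<^bsub>J\<^esub>" using x lmod_hom_zero[OF f X lJ] by simp
  qed
  have Bne: "B \<noteq> {}" unfolding B_def using X.M.zero_closed by blast
  define \<G> where "\<G> = {G. partial_graph R Y J G \<and> B \<subseteq> G}"
  have "\<exists>M\<in>\<G>. \<forall>G\<in>\<G>. M \<subseteq> G \<longrightarrow> G = M"
  proof (rule subset_Zorn_nonempty)
    show "\<G> \<noteq> {}" using B by (auto simp: \<G>_def)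
  next
    fix \<C> assume ne: "\<C> \<noteq> {}" and ch: "subset.chain \<G> \<C>"
    have sub: "\<And>G. G \<in> \<C> \<Longrightarrow> partial_graph R Y J G \<and> B \<subseteq> G"
      using ch unfolding subset_chain_def \<G>_def by blast
    have dir: "\<exists>G\<in>\<C>. p \<in> G \<and> q \<in> G" if "p \<in> \<Union>\<C>" "q \<in> \<Union>\<C>" for p q
      using that ch unfolding subset_chain_def by blast
    have "partial_graph R Y J (\<Union>\<C>)"
      unfolding partial_graph_def
    proof (intro conjI allI impI)
      show "\<Union>\<C> \<subseteq> carrier Y \<times> carrier J"
        using sub unfolding partial_graph_def by blast
    next
      fix a b a' b' assume "(a, b) \<in> \<Union>\<C>" "(a', b') \<in> \<Union>\<C>"
      then obtain G where "G \<in> \<C>" "(a, b) \<in> G" "(a', b') \<in> G" using dir by meson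
      then show "(a \<oplus>\<^bsub>Y\<^esub> a', b \<oplus>\<^bsub>J\<^esub> b') \<in> \<Union>\<C>"
        using sub unfolding partial_graph_def by blast
    next
      fix r a b assume "r \<in> carrier R" "(a, b) \<in> \<Union>\<C>"
      then show "(r \<odot>\<^bsub>Y\<^esub> a, r \<odot>\<^bsub>J\<^esub> b) \<in> \<Union>\<C>"
        using sub unfolding partial_graph_def by blast
    next
      fix b assume "(\<zero>\<^bsub>Y\<^esub>, b) \<in> \<Union>\<C>"
      then show "b = \<zero>\<^bsub>J\<^esub>" using sub unfolding partial_graph_def by blast
    qed
    then show "\<Union>\<C> \<in> \<G>" using sub ne by (auto simp: \<G>_def)
  qed
  then obtain M where MG: "M \<in> \<G>" and max: "\<forall>G\<in>\<G>. M \<subseteq> G \<longrightarrow> G = M" ..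
  have M: "partial_graph R Y J M" "B \<subseteq> M" using MG by (auto simp: \<G>_def)
  have tot: "y \<in> fst ` M" if y: "y \<in> carrier Y" for y
  proof -
    have "M \<noteq> {}" using M(2) Bne by auto
    from partial_graph_step[OF inj Y M(1) this y] obtain G'
      where G': "partial_graph R Y J G'" "M \<subseteq> G'" "y \<in> fst ` G'" by auto
    then have "G' \<in> \<G>" using M(2) by (auto simp: \<G>_def)
    then have "G' = M" using max G'(2) by auto
    then show ?thesis using G'(3) by simp
  qed
  have un: "\<And>y z z'. (y, z) \<in> M \<Longrightarrow> (y, z') \<in> M \<Longrightarrow> z = z'"
    using partial_graph_unique[OF M(1) Y lJ] by blast
  define g where "g = (\<lambda>y. THE z. (y, z) \<in> M)"
  have g: "g y = z" if "(y, z) \<in> M" for y z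
    unfolding g_def using that un by (intro the_equality) auto
  have gM: "(y, g y) \<in> M" if "y \<in> carrier Y" for y
    using tot[OF that] g by force
  have Msub: "\<And>y z. (y, z) \<in> M \<Longrightarrow> z \<in> carrier J"
    and Madd: "\<And>y z y' z'. (y, z) \<in> M \<Longrightarrow> (y', z') \<in> M \<Longrightarrow> (y \<oplus>\<^bsub>Y\<^esub> y', z \<oplus>\<^bsub>J\<^esub> z') \<in> M"
    and Msm: "\<And>r y z. r \<in> carrier R \<Longrightarrow> (y, z) \<in> M \<Longrightarrow> (r \<odot>\<^bsub>Y\<^esub> y, r \<odot>\<^bsub>J\<^esub> z) \<in> M"
    using M(1) unfolding partial_graph_def by blast+
  have "g \<in> lmod_hom R Y J"
    unfolding lmod_hom_def
  proof (intro CollectI conjI ballI Pi_I)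
    show "g y \<in> carrier J" if "y \<in> carrier Y" for y
      using Msub[OF gM[OF that]] .
    show "g (y \<oplus>\<^bsub>Y\<^esub> y') = g y \<oplus>\<^bsub>J\<^esub> g y'" if "y \<in> carrier Y" "y' \<in> carrier Y" for y y'
      using g[OF Madd[OF gM[OF that(1)] gM[OF that(2)]]] .
    show "g (r \<odot>\<^bsub>Y\<^esub> y) = r \<odot>\<^bsub>J\<^esub> g y" if "r \<in> carrier R" "y \<in> carrier Y" for r y
      using g[OF Msm[OF that(1) gM[OF that(2)]]] .
  qed
  moreover have "g (i x) = f x" if "x \<in> carrier X" for x
    using that M(2) by (intro g) (auto simp: B_def)
  ultimately show ?thesis by blast
qed

corollary injective_module_imp_injective_over:
  assumes "injective_module R J"
  shows "injective_over TYPE('u) R J"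
proof -
  have "left_module R J"
    using assms by (simp add: injective_module_def injective_over_def)
  then show ?thesis
    unfolding injective_over_def
    by (intro conjI allI impI injective_module_extends[OF assms]) auto
qed

section \<open>Complexes\<close>

record ('r, 'm) cochain =
  cterm :: "int \<Rightarrow> ('r, 'm) module"
  cdiff :: "int \<Rightarrow> 'm \<Rightarrow> 'm"

definition cochain_complex :: "('r, 'c) ring_scheme \<Rightarrow> ('r, 'm) cochain \<Rightarrow> bool" where
  "cochain_complex R C \<longleftrightarrow>
    (\<forall>n. left_module R (cterm C n)) \<and>
    (\<forall>n. cdiff C n \<in> lmod_hom R (cterm C n) (cterm C (n + 1))) \<and>
    (\<forall>n. \<forall>x\<in>carrier (cterm C n). cdiff C (n + 1) (cdiff C n x) = \<zero>\<^bsub>cterm C (n + 2)\<^esub>)"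

definition bounded_below :: "('r, 'm) cochain \<Rightarrow> bool" where
  "bounded_below C \<longleftrightarrow> (\<exists>N. \<forall>n<N. carrier (cterm C n) = {\<zero>\<^bsub>cterm C n\<^esub>})"

definition acyclic_complex :: "('r, 'm) cochain \<Rightarrow> bool" where
  "acyclic_complex C \<longleftrightarrow>
    (\<forall>n. a_kernel (cterm C n) (cterm C (n + 1)) (cdiff C n) =
      cdiff C (n - 1) ` carrier (cterm C (n - 1)))"

definition homotopic ::
    "('r, 'c) ring_scheme \<Rightarrow> ('r, 'm) cochain \<Rightarrow> ('r, 'n) cochain
      \<Rightarrow> (int \<Rightarrow> 'm \<Rightarrow> 'n) \<Rightarrow> (int \<Rightarrow> 'm \<Rightarrow> 'n) \<Rightarrow> bool" where
  "homotopic R C D f g \<longleftrightarrow>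
    (\<exists>h. (\<forall>n. h n \<in> lmod_hom R (cterm C n) (cterm D (n - 1))) \<and>
      (\<forall>n. \<forall>x\<in>carrier (cterm C n).
        f n x \<ominus>\<^bsub>cterm D n\<^esub> g n x =
          cdiff D (n - 1) (h n x) \<oplus>\<^bsub>cterm D n\<^esub> h (n + 1) (cdiff C n x)))"

definition contractible :: "('r, 'c) ring_scheme \<Rightarrow> ('r, 'm) cochain \<Rightarrow> bool" where
  "contractible R C \<longleftrightarrow> homotopic R C C (\<lambda>n x. x) (\<lambda>n x. \<zero>\<^bsub>cterm C n\<^esub>)"

definition nonneg_complex ::
    "(nat \<Rightarrow> ('r, 'm) module) \<Rightarrow> (nat \<Rightarrow> 'm \<Rightarrow> 'm) \<Rightarrow> ('r, 'm) cochain" where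
  "nonneg_complex I d =
    (let T = (\<lambda>n::int. if n < 0 then zero_module else I (nat n)) in
     \<lparr>cterm = T, cdiff = (\<lambda>n. if n < 0 then (\<lambda>_. \<zero>\<^bsub>T (n + 1)\<^esub>) else d (nat n))\<rparr>)"

definition injective_coresolution ::
    "('r, 'c) ring_scheme \<Rightarrow> ('r, 'n) module \<Rightarrow> ('n \<Rightarrow> 'm)
      \<Rightarrow> (nat \<Rightarrow> ('r, 'm) module) \<Rightarrow> (nat \<Rightarrow> 'm \<Rightarrow> 'm) \<Rightarrow> bool" where
  "injective_coresolution R M \<epsilon> I d \<longleftrightarrow>
    left_module R M \<and>
    (\<forall>n. injective_module R (I n)) \<and>
    \<epsilon> \<in> lmod_hom R M (I 0) \<and>
    (\<forall>n. d n \<in> lmod_hom R (I n) (I (Suc n))) \<and>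
    inj_on \<epsilon> (carrier M) \<and>
    a_kernel (I 0) (I 1) (d 0) = \<epsilon> ` carrier M \<and>
    (\<forall>n. a_kernel (I (Suc n)) (I (Suc (Suc n))) (d (Suc n)) = d n ` carrier (I n))"


section \<open>The functor \<open>Hom(J, -)\<close>\<close>

text \<open>Elements of Hom modules are functions that are \<^const>\<open>undefined\<close> outside the carrier, so
  that equality of functions is equality of homomorphisms.\<close>

definition Hom_set ::
    "('r, 'c) ring_scheme \<Rightarrow> ('r, 'm) module \<Rightarrow> ('r, 'n) module \<Rightarrow> ('m \<Rightarrow> 'n) set" where
  "Hom_set R M N = lmod_hom R M N \<inter> extensional (carrier M)"

text \<open>The product \<open>s \<otimes> t\<close> in the opposite ring is \<open>t\<close> after \<open>s\<close>.\<close>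

definition End_op :: "('r, 'c) ring_scheme \<Rightarrow> ('r, 'm) module \<Rightarrow> ('m \<Rightarrow> 'm) ring" where
  "End_op R J =
    \<lparr>carrier = Hom_set R J J,
     mult = (\<lambda>s t. compose (carrier J) t s),
     one = (\<lambda>x\<in>carrier J. x),
     zero = (\<lambda>x\<in>carrier J. \<zero>\<^bsub>J\<^esub>),
     add = (\<lambda>s t. \<lambda>x\<in>carrier J. s x \<oplus>\<^bsub>J\<^esub> t x)\<rparr>"

text \<open>\<open>Hom(J, M)\<close> as a left module over \<^const>\<open>End_op\<close>, acting by precomposition.\<close>

definition Hom_module ::
    "('r, 'c) ring_scheme \<Rightarrow> ('r, 'm) module \<Rightarrow> ('r, 'n) module
      \<Rightarrow> ('m \<Rightarrow> 'm, 'm \<Rightarrow> 'n) module" where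
  "Hom_module R J M =
    \<lparr>carrier = Hom_set R J M,
     mult = undefined, one = undefined,
     zero = (\<lambda>x\<in>carrier J. \<zero>\<^bsub>M\<^esub>),
     add = (\<lambda>f g. \<lambda>x\<in>carrier J. f x \<oplus>\<^bsub>M\<^esub> g x),
     smult = (\<lambda>s f. compose (carrier J) f s)\<rparr>"

definition Hom_complex ::
    "('r, 'c) ring_scheme \<Rightarrow> ('r, 'm) module \<Rightarrow> ('r, 'n) cochain
      \<Rightarrow> ('m \<Rightarrow> 'm, 'm \<Rightarrow> 'n) cochain" where
  "Hom_complex R J C =
    \<lparr>cterm = (\<lambda>n. Hom_module R J (cterm C n)),
     cdiff = (\<lambda>n f. compose (carrier J) (cdiff C n) f)\<rparr>"


section \<open>The polynomial ring and its residue field\<close>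

text \<open>Monomials in variables indexed by \<open>'a\<close> are finitely supported exponent functions
  \<^typ>\<open>'a \<Rightarrow>\<^sub>0 nat\<close>; polynomials are finitely supported coefficient functions on
  monomials, with the convolution product.\<close>

type_synonym ('a, 'k) mpoly = "('a \<Rightarrow>\<^sub>0 nat) \<Rightarrow>\<^sub>0 'k"

definition mpoly_ring :: "('a, 'k::field) mpoly ring" where
  "mpoly_ring = \<lparr>carrier = UNIV, mult = (*), one = 1, zero = 0, add = (+)\<rparr>"

lemma cring_mpoly_ring: "cring mpoly_ring"
proof unfold_locales
  show "carrier (add_monoid mpoly_ring) \<subseteq> Units (add_monoid mpoly_ring)"
    unfolding Units_def mpoly_ring_def
    by (auto intro!: exI[where x = "- _"])
qed (auto simp: mpoly_ring_def algebra_simps)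

definition mpoly_var :: "'a \<Rightarrow> ('a, 'k::field) mpoly" where
  "mpoly_var a = Poly_Mapping.single (Poly_Mapping.single a 1) 1"

text \<open>The field with all variables acting by zero: a polynomial acts by multiplication with
  its constant coefficient.\<close>

definition residue_module :: "(('a, 'k::field) mpoly, 'k) module" where
  "residue_module =
    \<lparr>carrier = UNIV, mult = (*), one = 1, zero = 0, add = (+),
     smult = (\<lambda>p c. Poly_Mapping.lookup p 0 * c)\<rparr>"

lemma residue_module_var: "mpoly_var a \<odot>\<^bsub>residue_module\<^esub> c = 0"
  by (simp add: residue_module_def mpoly_var_def lookup_single when_def
      poly_mapping_eq_iff fun_eq_iff)

lemma residue_module_const: "Poly_Mapping.single 0 b \<odot>\<^bsub>residue_module\<^esub> c = b * c"
  by (simp add: residue_module_def)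

lemma lookup_times_zero:
  fixes p q :: "('a, 'k::field) mpoly"
  shows "Poly_Mapping.lookup (p * q) 0 = Poly_Mapping.lookup p 0 * Poly_Mapping.lookup q 0"
proof -
  have *: "(0 = l + m) \<longleftrightarrow> l = 0 \<and> m = 0" for l m :: "'a \<Rightarrow>\<^sub>0 nat"
    by (auto simp: poly_mapping_eq_iff fun_eq_iff lookup_add)
  have "(\<Sum>m. Poly_Mapping.lookup q m when 0 = l + m) = (Poly_Mapping.lookup q 0 when l = 0)" for l
    by (cases "l = 0") (simp_all add: *)
  then show ?thesis
    by (simp add: times_poly_mapping.rep_eq prod_fun_def mult_when)
qed

lemma left_module_residue_module:
  "left_module mpoly_ring (residue_module :: (('a, 'k::field) mpoly, 'k) module)"
proof -
  interpret cring "mpoly_ring :: ('a, 'k) mpoly ring" by (rule cring_mpoly_ring)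
  show ?thesis
  proof unfold_locales
    show "carrier (add_monoid residue_module) \<subseteq> Units (add_monoid residue_module)"
      unfolding Units_def residue_module_def by (auto intro!: exI[where x = "- _"])
  qed (auto simp: residue_module_def mpoly_ring_def algebra_simps lookup_add
      lookup_times_zero lookup_one)
qed

end

theory Submission
  imports Defs "HOL-Algebra.Ideal"
begin

text \<open>Finite generation, projectivity and noncontractibility hold because each \<open>I n\<close> is a retract
  of \<open>J\<close>. Acyclicity is the vanishing of all \<open>Ext\<^sup>n(J, k)\<close>. For a finite set \<open>A\<close> of variables let
  \<open>J\<^sub>A\<close> be the submodule of \<open>J\<close> annihilated by \<open>A\<close>. A variable \<open>b \<notin> A\<close> acts injectively on
  \<open>R/(A)\<close>, hence surjectively on \<open>J\<^sub>A\<close>, with kernel \<open>J\<^sub>B\<close> for \<open>B = A \<union> {b}\<close>; it acts by zero on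
  \<open>k\<close>, so the long exact sequence embeds \<open>Ext\<^sup>n\<^sup>+\<^sup>1(J\<^sub>A, k)\<close> into itself by the zero map once
  \<open>Ext\<^sup>n(J\<^sub>B, k) = 0\<close>. There is always a further variable, so induction on \<open>n\<close> gives
  \<open>Ext\<^sup>n(J\<^sub>A, k) = 0\<close> for all finite \<open>A\<close>, in particular for the empty set.\<close>

section \<open>Homomorphisms and submodules\<close>

lemma (in abelian_group) diff_self: "x \<in> carrier G \<Longrightarrow> x \<ominus> x = \<zero>"
  by (simp add: a_minus_def r_neg)

lemma (in abelian_group) eq_if_diff_zero:
  assumes "x \<in> carrier G" "y \<in> carrier G" "x \<ominus> y = \<zero>"
  shows "x = y"
  using assms minus_equality[of x "\<ominus> y"] by (simp add: a_minus_def)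

lemma (in left_module) smult_minus:
  assumes "a \<in> carrier R" "x \<in> carrier M"
  shows "a \<odot>\<^bsub>M\<^esub> (\<ominus>\<^bsub>M\<^esub> x) = \<ominus>\<^bsub>M\<^esub> (a \<odot>\<^bsub>M\<^esub> x)"
proof -
  have "a \<odot>\<^bsub>M\<^esub> (\<ominus>\<^bsub>M\<^esub> x) \<oplus>\<^bsub>M\<^esub> a \<odot>\<^bsub>M\<^esub> x = \<zero>\<^bsub>M\<^esub>"
    using assms by (simp add: M.l_neg flip: smult_r_distr)
  then show ?thesis using assms by (simp add: M.minus_equality)
qed

text \<open>Closure of \<open>H\<close> under negation comes from acting by
  \<open>\<ominus> \<one>\<close>.\<close>

lemma (in left_module) left_module_carrier_update:
  assumes "H \<subseteq> carrier M" "\<zero>\<^bsub>M\<^esub> \<in> H"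
    and "\<And>x y. \<lbrakk>x \<in> H; y \<in> H\<rbrakk> \<Longrightarrow> x \<oplus>\<^bsub>M\<^esub> y \<in> H"
    and sm: "\<And>r x. \<lbrakk>r \<in> carrier R; x \<in> H\<rbrakk> \<Longrightarrow> r \<odot>\<^bsub>M\<^esub> x \<in> H"
  shows "left_module R (M\<lparr>carrier := H\<rparr>)"
proof unfold_locales
  have H: "x \<in> carrier M" if "x \<in> H" for x using that assms(1) by blast
  have inv: "\<ominus>\<^bsub>M\<^esub> x \<in> H" if "x \<in> H" for x
    using sm[of "\<ominus> \<one>" x] that H by (simp add: minus_smult)
  show "carrier (add_monoid (M\<lparr>carrier := H\<rparr>)) \<subseteq> Units (add_monoid (M\<lparr>carrier := H\<rparr>))"
    unfolding Units_def using inv H by (auto intro!: bexI[of _ "\<ominus>\<^bsub>M\<^esub> _"] simp: M.l_neg M.r_neg)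
qed (use assms in \<open>auto simp: subset_iff M.a_ac smult_l_distr smult_r_distr smult_assoc1\<close>)

lemma lmod_hom_comp:
  assumes "f \<in> lmod_hom R L M" "g \<in> lmod_hom R M N"
  shows "(\<lambda>x. g (f x)) \<in> lmod_hom R L N"
  using assms by (auto simp: lmod_hom_def Pi_iff)

lemma lmod_hom_minus:
  assumes f: "f \<in> lmod_hom R M N" and M: "left_module R M" and N: "left_module R N"
    and x: "x \<in> carrier M"
  shows "f (\<ominus>\<^bsub>M\<^esub> x) = \<ominus>\<^bsub>N\<^esub> f x"
proof -
  interpret M: left_module R M by fact
  interpret N: left_module R N by fact
  have "f (\<ominus>\<^bsub>M\<^esub> x) \<oplus>\<^bsub>N\<^esub> f x = \<zero>\<^bsub>N\<^esub>"
    using x lmod_hom_zero[OF f M N] by (simp add: M.M.l_neg flip: lmod_homD(2)[OF f])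
  then show ?thesis using x lmod_homD(1)[OF f] by (simp add: N.M.minus_equality)
qed

lemma lmod_hom_diff:
  assumes f: "f \<in> lmod_hom R M N" and M: "left_module R M" and N: "left_module R N"
    and "x \<in> carrier M" "y \<in> carrier M"
  shows "f (x \<ominus>\<^bsub>M\<^esub> y) = f x \<ominus>\<^bsub>N\<^esub> f y"
proof -
  interpret M: left_module R M by fact
  show ?thesis using assms
    by (simp add: a_minus_def lmod_homD[OF f] lmod_hom_minus[OF f M N])
qed

lemma lmod_hom_const_zero:
  assumes "left_module R N"
  shows "(\<lambda>x. \<zero>\<^bsub>N\<^esub>) \<in> lmod_hom R M N"
proof -
  interpret left_module R N by fact
  show ?thesis by (simp add: lmod_hom_def)
qed

lemma lmod_hom_closed_add:
  assumes f: "f \<in> lmod_hom R M N" and g: "g \<in> lmod_hom R M N" and "left_module R N"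
  shows "(\<lambda>x. f x \<oplus>\<^bsub>N\<^esub> g x) \<in> lmod_hom R M N"
proof -
  interpret N: left_module R N by fact
  show ?thesis
    unfolding lmod_hom_def
    by (auto simp: lmod_homD[OF f] lmod_homD[OF g] N.smult_r_distr N.M.a_ac)
qed

lemma lmod_hom_closed_uminus:
  assumes f: "f \<in> lmod_hom R M N" and "left_module R N"
  shows "(\<lambda>x. \<ominus>\<^bsub>N\<^esub> f x) \<in> lmod_hom R M N"
proof -
  interpret N: left_module R N by fact
  show ?thesis
    unfolding lmod_hom_def
    by (auto simp: lmod_homD[OF f] N.smult_minus N.M.minus_add)
qed

lemma lmod_hom_closed_diff:
  assumes "f \<in> lmod_hom R M N" "g \<in> lmod_hom R M N" "left_module R N"
  shows "(\<lambda>x. f x \<ominus>\<^bsub>N\<^esub> g x) \<in> lmod_hom R M N"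
  unfolding a_minus_def by (intro lmod_hom_closed_add lmod_hom_closed_uminus assms)

text \<open>Since \<open>R\<close> is commutative, acting by \<open>r\<close> commutes with the
  action of every other scalar.\<close>

lemma lmod_hom_closed_smult:
  assumes "cring R" "left_module R N" "r \<in> carrier R" and f: "f \<in> lmod_hom R M N"
  shows "(\<lambda>x. r \<odot>\<^bsub>N\<^esub> f x) \<in> lmod_hom R M N"
proof -
  interpret R: cring R by fact
  interpret N: left_module R N by fact
  show ?thesis
    unfolding lmod_hom_def
    using assms(3)
    by (auto simp: lmod_homD[OF f] N.smult_r_distr R.m_comm simp flip: N.smult_assoc1)
qed

lemma lmod_hom_id: "(\<lambda>x. x) \<in> lmod_hom R M M"
  by (simp add: lmod_hom_def)

lemma lmod_hom_restrict_carrier: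
  assumes "f \<in> lmod_hom R M N" "H \<subseteq> carrier M"
  shows "f \<in> lmod_hom R (M\<lparr>carrier := H\<rparr>) N"
  using assms by (auto simp: lmod_hom_def Pi_iff subset_iff)


section \<open>Exactness properties of injective modules and coresolutions\<close>

text \<open>This is exactness of \<open>Hom(-, I)\<close>: \<open>h\<close> kills the kernel of
  \<open>d\<close>, so it descends to the image of \<open>d\<close>, and the descended map extends
  to \<open>C\<close> by injectivity.\<close>

lemma injective_module_factor:
  fixes R :: "('r, 'c) ring_scheme" and B :: "('r, 'u) module" and C :: "('r, 'v) module"
  assumes I: "injective_module R I" and B: "left_module R B" and C: "left_module R C"
    and d: "d \<in> lmod_hom R B C" and h: "h \<in> lmod_hom R B I"
    and ker: "\<And>x. \<lbrakk>x \<in> carrier B; d x = \<zero>\<^bsub>C\<^esub>\<rbrakk> \<Longrightarrow> h x = \<zero>\<^bsub>I\<^esub>"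
  shows "\<exists>u\<in>lmod_hom R C I. \<forall>x\<in>carrier B. u (d x) = h x"
proof -
  have lI: "left_module R I" using I by (simp add: injective_module_def injective_over_def)
  interpret B: left_module R B by fact
  interpret C: left_module R C by fact
  interpret I: left_module R I by (rule lI)
  note dD = lmod_homD[OF d] and hD = lmod_homD[OF h]
  define X where "X = C\<lparr>carrier := d ` carrier B\<rparr>"
  have X: "left_module R X"
    unfolding X_def
  proof (rule C.left_module_carrier_update)
    show "\<zero>\<^bsub>C\<^esub> \<in> d ` carrier B" using lmod_hom_zero[OF d B C] by (metis B.M.zero_closed imageI)
  qed (auto simp: dD(1) simp flip: dD(2,3))
  have eq: "h x = h y" if "x \<in> carrier B" "y \<in> carrier B" "d x = d y" for x y
  proof -
    have "d (x \<ominus>\<^bsub>B\<^esub> y) = \<zero>\<^bsub>C\<^esub>"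
      using that dD(1) by (simp add: lmod_hom_diff[OF d B C] C.M.diff_self)
    then have "h x \<ominus>\<^bsub>I\<^esub> h y = \<zero>\<^bsub>I\<^esub>"
      using ker[of "x \<ominus>\<^bsub>B\<^esub> y"] that by (simp add: lmod_hom_diff[OF h B lI])
    then show ?thesis using that hD(1) by (simp add: I.M.eq_if_diff_zero)
  qed
  define w where "w = (\<lambda>y. h (SOME x. x \<in> carrier B \<and> d x = y))"
  have w: "w (d x) = h x" if "x \<in> carrier B" for x
    unfolding w_def using someI[of "\<lambda>x'. x' \<in> carrier B \<and> d x' = d x" x] that
    by (intro eq) auto
  have "w \<in> lmod_hom R X I"
    unfolding lmod_hom_def X_def
    by (auto simp: w hD simp flip: dD(2,3))
  moreover have "(\<lambda>x. x) \<in> lmod_hom R X C"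
    by (auto simp: lmod_hom_def X_def dD)
  ultimately obtain u where "u \<in> lmod_hom R C I" "\<forall>y\<in>carrier X. u y = w y"
    using injective_module_extends[OF I X C, of "\<lambda>x. x" w] by auto
  then show ?thesis using w by (auto simp: X_def)
qed

text \<open>Exactness in terms of elements: facts 6 and 7 at \<open>I 0\<close>, facts 8 and 9 at
  \<open>I (Suc n)\<close>.\<close>

lemma coresolutionD:
  assumes "injective_coresolution R M \<epsilon> I d"
  shows "left_module R M" "injective_module R (I n)" "left_module R (I n)"
    "\<epsilon> \<in> lmod_hom R M (I 0)" "d n \<in> lmod_hom R (I n) (I (Suc n))"
    "m \<in> carrier M \<Longrightarrow> d 0 (\<epsilon> m) = \<zero>\<^bsub>I 1\<^esub>"
    "\<lbrakk>y \<in> carrier (I 0); d 0 y = \<zero>\<^bsub>I 1\<^esub>\<rbrakk> \<Longrightarrow> \<exists>m\<in>carrier M. y = \<epsilon> m"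
    "x \<in> carrier (I n) \<Longrightarrow> d (Suc n) (d n x) = \<zero>\<^bsub>I (Suc (Suc n))\<^esub>"
    "\<lbrakk>y \<in> carrier (I (Suc n)); d (Suc n) y = \<zero>\<^bsub>I (Suc (Suc n))\<^esub>\<rbrakk> \<Longrightarrow> \<exists>x\<in>carrier (I n). y = d n x"
  using assms unfolding injective_coresolution_def a_kernel_def' injective_module_def injective_over_def
  by (fastforce simp: set_eq_iff)+

section \<open>Dimension shifting\<close>

text \<open>An element acting by zero on \<open>M\<close> acts on the coresolution by a null-homotopic map; \<open>s\<close> is
  the homotopy, restricted to cocycles.\<close>

lemma coresolution_smult_null_homotopic:
  assumes R: "cring R" and res: "injective_coresolution R M \<epsilon> I d"
    and r: "r \<in> carrier R" and rM: "\<And>m. m \<in> carrier M \<Longrightarrow> r \<odot>\<^bsub>M\<^esub> m = \<zero>\<^bsub>M\<^esub>"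
  shows "\<exists>s\<in>lmod_hom R (I (Suc n)) (I n). \<forall>y\<in>carrier (I (Suc n)).
    d (Suc n) y = \<zero>\<^bsub>I (Suc (Suc n))\<^esub> \<longrightarrow> d n (s y) = r \<odot>\<^bsub>I (Suc n)\<^esub> y"
proof (induction n)
  note D = coresolutionD[OF res]
  case 0
  interpret I0: left_module R "I 0" by (rule D)
  \<comment> \<open>The kernel of \<open>d 0\<close> is the image of \<open>\<epsilon>\<close>,
    which \<open>r\<close> kills; hence multiplication by \<open>r\<close> factors through
    \<open>d 0\<close>.\<close>
  have "\<exists>s\<in>lmod_hom R (I (Suc 0)) (I 0). \<forall>x\<in>carrier (I 0). s (d 0 x) = r \<odot>\<^bsub>I 0\<^esub> x"
  proof (rule injective_module_factor)
    show "(\<lambda>x. r \<odot>\<^bsub>I 0\<^esub> x) \<in> lmod_hom R (I 0) (I 0)"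
      by (rule lmod_hom_closed_smult[OF R D(3) r lmod_hom_id])
    show "r \<odot>\<^bsub>I 0\<^esub> x = \<zero>\<^bsub>I 0\<^esub>" if x: "x \<in> carrier (I 0)" "d 0 x = \<zero>\<^bsub>I (Suc 0)\<^esub>" for x
    proof -
      obtain m where m: "m \<in> carrier M" "x = \<epsilon> m" using D(7) x by auto
      then show ?thesis
        using rM[of m] lmod_homD(3)[OF D(4) r, of m] lmod_hom_zero[OF D(4) D(1) D(3)] by simp
    qed
  qed (rule D)+
  then obtain s where s: "s \<in> lmod_hom R (I (Suc 0)) (I 0)"
    "\<forall>x\<in>carrier (I 0). s (d 0 x) = r \<odot>\<^bsub>I 0\<^esub> x" by blast
  \<comment> \<open>Exactness writes the cocycle as \<open>y = d 0 x\<close>, so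
    \<open>d 0 (s y) = d 0 (r x) = r y\<close>.\<close>
  have "d 0 (s y) = r \<odot>\<^bsub>I (Suc 0)\<^esub> y"
    if y: "y \<in> carrier (I (Suc 0))" "d (Suc 0) y = \<zero>\<^bsub>I (Suc (Suc 0))\<^esub>" for y
    using D(9)[OF y] s(2) lmod_homD(3)[OF D(5) r] by auto
  then show ?case using s(1) by blast
next
  note D = coresolutionD[OF res]
  case (Suc n)
  then obtain s where s: "s \<in> lmod_hom R (I (Suc n)) (I n)"
    and ds: "\<And>y. \<lbrakk>y \<in> carrier (I (Suc n)); d (Suc n) y = \<zero>\<^bsub>I (Suc (Suc n))\<^esub>\<rbrakk>
      \<Longrightarrow> d n (s y) = r \<odot>\<^bsub>I (Suc n)\<^esub> y" by blast
  interpret I1: left_module R "I (Suc n)" by (rule D)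
  interpret I2: left_module R "I (Suc (Suc n))" by (rule D)
  \<comment> \<open>On cocycles \<open>d n (s x) = r x\<close> by induction, so the difference
    \<open>h\<close> vanishes there and factors through \<open>d (Suc n)\<close>.\<close>
  define h where "h = (\<lambda>x. r \<odot>\<^bsub>I (Suc n)\<^esub> x \<ominus>\<^bsub>I (Suc n)\<^esub> d n (s x))"
  have "\<exists>t\<in>lmod_hom R (I (Suc (Suc n))) (I (Suc n)). \<forall>x\<in>carrier (I (Suc n)). t (d (Suc n) x) = h x"
  proof (rule injective_module_factor)
    show "h \<in> lmod_hom R (I (Suc n)) (I (Suc n))" unfolding h_def
      by (rule lmod_hom_closed_diff[OF lmod_hom_closed_smult[OF R D(3) r lmod_hom_id] lmod_hom_comp[OF s D(5)] D(3)])
    show "h x = \<zero>\<^bsub>I (Suc n)\<^esub>"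
      if x: "x \<in> carrier (I (Suc n))" "d (Suc n) x = \<zero>\<^bsub>I (Suc (Suc n))\<^esub>" for x
      using ds[OF x] x(1) r by (simp add: h_def a_minus_def I1.M.r_neg)
  qed (rule D)+
  then obtain t where t: "t \<in> lmod_hom R (I (Suc (Suc n))) (I (Suc n))"
    "\<forall>x\<in>carrier (I (Suc n)). t (d (Suc n) x) = h x" by blast
  have "d (Suc n) (t y) = r \<odot>\<^bsub>I (Suc (Suc n))\<^esub> y"
    if y: "y \<in> carrier (I (Suc (Suc n)))" "d (Suc (Suc n)) y = \<zero>\<^bsub>I (Suc (Suc (Suc n)))\<^esub>" for y
  proof -
    obtain x where x: "x \<in> carrier (I (Suc n))" "y = d (Suc n) x" using D(9)[OF y] by blast
    have c: "s x \<in> carrier (I n)" "d n (s x) \<in> carrier (I (Suc n))"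
      using x lmod_homD(1)[OF s] lmod_homD(1)[OF D(5)] by auto
    \<comment> \<open>The subtracted term disappears because \<open>d (Suc n)\<close> after
      \<open>d n\<close> is zero.\<close>
    have "d (Suc n) (h x) = d (Suc n) (r \<odot>\<^bsub>I (Suc n)\<^esub> x) \<ominus>\<^bsub>I (Suc (Suc n))\<^esub> d (Suc n) (d n (s x))"
      unfolding h_def using x c r by (intro lmod_hom_diff[OF D(5) D(3) D(3)]) auto
    then show ?thesis
      using x t(2) c r lmod_homD(1)[OF D(5)]
      by (simp add: D(8) lmod_homD(3)[OF D(5)] a_minus_def)
  qed
  then show ?case using t(1) by blast
qed

section \<open>Vanishing of Ext in terms of cocycles\<close>

text \<open>For an injective coresolution \<open>I\<close> of \<open>M\<close> this says
  \<open>Ext^n(B, M) = 0\<close>. No differential enters degree 0, so a cocycle there must itself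
  vanish.\<close>

definition cocycles_bound ::
    "('r, 'c) ring_scheme \<Rightarrow> (nat \<Rightarrow> ('r, 'm) module) \<Rightarrow> (nat \<Rightarrow> 'm \<Rightarrow> 'm) \<Rightarrow> nat
      \<Rightarrow> ('r, 'b) module \<Rightarrow> bool" where
  "cocycles_bound R I d n B \<longleftrightarrow>
    (\<forall>f\<in>lmod_hom R B (I n). (\<forall>x\<in>carrier B. d n (f x) = \<zero>\<^bsub>I (Suc n)\<^esub>) \<longrightarrow>
      (case n of 0 \<Rightarrow> \<forall>x\<in>carrier B. f x = \<zero>\<^bsub>I 0\<^esub>
       | Suc k \<Rightarrow> \<exists>g\<in>lmod_hom R B (I k). \<forall>x\<in>carrier B. f x = d k (g x)))"

text \<open>A cocycle \<open>f\<close> in degree 0 takes values in the image of \<open>M\<close>,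
  where \<open>r\<close> acts by zero; with \<open>x = r y\<close> this gives
  \<open>f x = r (f y) = 0\<close>.\<close>

lemma cocycles_bound_0:
  assumes res: "injective_coresolution R M \<epsilon> I d"
    and r: "r \<in> carrier R" and rM: "\<And>m. m \<in> carrier M \<Longrightarrow> r \<odot>\<^bsub>M\<^esub> m = \<zero>\<^bsub>M\<^esub>"
    and surj: "\<And>x. x \<in> carrier B \<Longrightarrow> \<exists>y\<in>carrier B. r \<odot>\<^bsub>B\<^esub> y = x"
  shows "cocycles_bound R I d 0 B"
  unfolding cocycles_bound_def
proof (simp, intro ballI impI)
  note D = coresolutionD[OF res]
  fix f x assume f: "f \<in> lmod_hom R B (I 0)" and df: "\<forall>x\<in>carrier B. d 0 (f x) = \<zero>\<^bsub>I (Suc 0)\<^esub>"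
    and "x \<in> carrier B"
  then obtain y where y: "y \<in> carrier B" "x = r \<odot>\<^bsub>B\<^esub> y" using surj by metis
  then obtain m where m: "m \<in> carrier M" "f y = \<epsilon> m"
    using D(7)[of "f y"] df lmod_homD(1)[OF f] by auto
  then show "f x = \<zero>\<^bsub>I 0\<^esub>"
    using y r rM[of m] lmod_homD(3)[OF D(4) r, of m] lmod_hom_zero[OF D(4) D(1) D(3)]
      lmod_homD(3)[OF f r] by simp
qed

text \<open>Dimension shifting along \<open>0 \<rightarrow> A \<rightarrow> B \<rightarrow> B \<rightarrow> 0\<close>, the second map being multiplication by
  \<open>r\<close>, which induces zero on \<open>Ext(B, M)\<close>.\<close>

lemma cocycles_bound_Suc:
  assumes R: "cring R" and res: "injective_coresolution R M \<epsilon> I d"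
    and r: "r \<in> carrier R" and rM: "\<And>m. m \<in> carrier M \<Longrightarrow> r \<odot>\<^bsub>M\<^esub> m = \<zero>\<^bsub>M\<^esub>"
    and B: "left_module R B"
    and surj: "\<And>x. x \<in> carrier B \<Longrightarrow> \<exists>y\<in>carrier B. r \<odot>\<^bsub>B\<^esub> y = x"
    and A_def: "A = B\<lparr>carrier := {x \<in> carrier B. r \<odot>\<^bsub>B\<^esub> x = \<zero>\<^bsub>B\<^esub>}\<rparr>"
    and A: "left_module R A"
    and bound: "cocycles_bound R I d n A"
  shows "cocycles_bound R I d (Suc n) B"
  unfolding cocycles_bound_def
proof (simp, intro ballI impI)
  note D = coresolutionD[OF res]
  fix f assume f: "f \<in> lmod_hom R B (I (Suc n))"
    and df: "\<forall>x\<in>carrier B. d (Suc n) (f x) = \<zero>\<^bsub>I (Suc (Suc n))\<^esub>"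
  interpret B: left_module R B by fact
  interpret In: left_module R "I n" by (rule D)
  interpret I1: left_module R "I (Suc n)" by (rule D)
  obtain s where s: "s \<in> lmod_hom R (I (Suc n)) (I n)"
    and ds: "\<And>y. \<lbrakk>y \<in> carrier (I (Suc n)); d (Suc n) y = \<zero>\<^bsub>I (Suc (Suc n))\<^esub>\<rbrakk>
      \<Longrightarrow> d n (s y) = r \<odot>\<^bsub>I (Suc n)\<^esub> y"
    using coresolution_smult_null_homotopic[OF R res r rM] by blast
  \<comment> \<open>\<open>d n\<close> after \<open>h\<close> is \<open>f\<close> after
    multiplication by \<open>r\<close>. Were \<open>h\<close> to factor through that multiplication,
    \<open>f\<close> would be a coboundary; the obstruction is the restriction of \<open>h\<close>
    to the kernel \<open>A\<close>.\<close>
  define h where "h = (\<lambda>x. s (f x))"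
  have h: "h \<in> lmod_hom R B (I n)" unfolding h_def by (rule lmod_hom_comp[OF f s])
  have dh: "d n (h x) = f (r \<odot>\<^bsub>B\<^esub> x)" if "x \<in> carrier B" for x
    using ds[of "f x"] df that lmod_homD(1,3)[OF f] r by (simp add: h_def)
  have AB: "carrier A \<subseteq> carrier B" by (auto simp: A_def)
  have incl: "(\<lambda>x. x) \<in> lmod_hom R A B" by (auto simp: lmod_hom_def A_def)
  have hA: "h \<in> lmod_hom R A (I n)"
    unfolding A_def by (rule lmod_hom_restrict_carrier[OF h]) auto
  have dhA: "\<forall>x\<in>carrier A. d n (h x) = \<zero>\<^bsub>I (Suc n)\<^esub>"
    using dh lmod_hom_zero[OF f B D(3)] by (auto simp: A_def)
  \<comment> \<open>The bound on \<open>A\<close> provides a cocycle \<open>e\<close> on all of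
    \<open>B\<close> that agrees with \<open>h\<close> on \<open>A\<close>, so subtracting it
    removes the obstruction and leaves \<open>d n (h x)\<close> unchanged.\<close>
  obtain e where e: "e \<in> lmod_hom R B (I n)" "\<forall>x\<in>carrier B. d n (e x) = \<zero>\<^bsub>I (Suc n)\<^esub>"
    "\<forall>x\<in>carrier A. e x = h x"
  proof (cases n)
    case 0
    have "\<forall>x\<in>carrier A. h x = \<zero>\<^bsub>I n\<^esub>"
      using bound hA dhA 0 by (simp add: cocycles_bound_def)
    then show ?thesis
      using that[of "\<lambda>x. \<zero>\<^bsub>I n\<^esub>"] lmod_hom_zero[OF D(5) D(3) D(3)]
      by (auto simp: lmod_hom_def)
  next
    case (Suc k)
    obtain g where g: "g \<in> lmod_hom R A (I k)" "\<forall>x\<in>carrier A. h x = d k (g x)"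
      using bound hA dhA Suc by (auto simp: cocycles_bound_def)
    \<comment> \<open>The cochain \<open>g\<close> with coboundary \<open>h\<close> on
      \<open>A\<close> extends to \<open>B\<close>, since \<open>I k\<close> is injective.\<close>
    obtain g' where g': "g' \<in> lmod_hom R B (I k)" "\<forall>x\<in>carrier A. g' x = g x"
      using injective_module_extends[OF D(2) A B incl _ g(1)] by auto
    show ?thesis
      by (rule that[of "\<lambda>x. d k (g' x)"])
        (use lmod_hom_comp[OF g'(1) D(5)] Suc g(2) g'(2) D(8) lmod_homD(1)[OF g'(1)] in auto)
  qed
  have "\<exists>u\<in>lmod_hom R B (I n). \<forall>x\<in>carrier B. u (r \<odot>\<^bsub>B\<^esub> x) = h x \<ominus>\<^bsub>I n\<^esub> e x"
  proof (rule injective_module_factor[OF D(2) B B lmod_hom_closed_smult[OF R B r lmod_hom_id]])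
    show "(\<lambda>x. h x \<ominus>\<^bsub>I n\<^esub> e x) \<in> lmod_hom R B (I n)"
      by (rule lmod_hom_closed_diff[OF h e(1) D(3)])
    show "h x \<ominus>\<^bsub>I n\<^esub> e x = \<zero>\<^bsub>I n\<^esub>" if "x \<in> carrier B" "r \<odot>\<^bsub>B\<^esub> x = \<zero>\<^bsub>B\<^esub>" for x
      using that e(3) lmod_homD(1)[OF h] by (simp add: A_def In.M.diff_self)
  qed
  then obtain u where u: "u \<in> lmod_hom R B (I n)"
    "\<forall>x\<in>carrier B. u (r \<odot>\<^bsub>B\<^esub> x) = h x \<ominus>\<^bsub>I n\<^esub> e x" by blast
  \<comment> \<open>With \<open>x = r y\<close>,
    \<open>d n (u x) = d n (h y) - d n (e y) = f (r y)\<close>, as \<open>e\<close> is a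
    cocycle.\<close>
  have "f x = d n (u x)" if "x \<in> carrier B" for x
  proof -
    obtain y where y: "y \<in> carrier B" "x = r \<odot>\<^bsub>B\<^esub> y" using surj \<open>x \<in> carrier B\<close> by metis
    have "d n (h y \<ominus>\<^bsub>I n\<^esub> e y) = d n (h y) \<ominus>\<^bsub>I (Suc n)\<^esub> d n (e y)"
      using y by (intro lmod_hom_diff[OF D(5) D(3) D(3)] lmod_homD(1)[OF h] lmod_homD(1)[OF e(1)])
    then show ?thesis
      using y u(2) e(2) dh lmod_homD(1)[OF f] r by (simp add: a_minus_def)
  qed
  then show "\<exists>g\<in>lmod_hom R B (I n). \<forall>x\<in>carrier B. f x = d n (g x)" using u(1) by blast
qed

section \<open>Torsion of injective modules over the polynomial ring\<close>

definition regular_module :: "('r, 'c) ring_scheme \<Rightarrow> ('r, 'r) module" where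
  "regular_module R =
    \<lparr>carrier = carrier R, mult = undefined, one = undefined, zero = \<zero>\<^bsub>R\<^esub>, add = add R,
     smult = mult R\<rparr>"

lemma left_module_regular_module:
  assumes "ring R"
  shows "left_module R (regular_module R)"
proof -
  interpret ring R by fact
  show ?thesis
  proof unfold_locales
    show "carrier (add_monoid (regular_module R)) \<subseteq> Units (add_monoid (regular_module R))"
      unfolding Units_def regular_module_def
      by (auto intro!: bexI[where x = "\<ominus>\<^bsub>R\<^esub> _"] simp: l_neg r_neg)
  qed (auto simp: regular_module_def a_ac l_distr r_distr m_assoc)
qed

text \<open>Baer extension of the homomorphism \<open>b R + N \<rightarrow> J\<close> sending \<open>b\<close> to \<open>z\<close> and \<open>N\<close> to zero.\<close>

lemma injective_module_divisible:
  assumes R: "cring R" and J: "injective_module R J" and N: "ideal N R" and b: "b \<in> carrier R"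
    and regular: "\<And>p. \<lbrakk>p \<in> carrier R; b \<otimes>\<^bsub>R\<^esub> p \<in> N\<rbrakk> \<Longrightarrow> p \<in> N"
    and z: "z \<in> carrier J" and Nz: "\<And>n. n \<in> N \<Longrightarrow> n \<odot>\<^bsub>J\<^esub> z = \<zero>\<^bsub>J\<^esub>"
  shows "\<exists>w\<in>carrier J. b \<odot>\<^bsub>J\<^esub> w = z \<and> (\<forall>n\<in>N. n \<odot>\<^bsub>J\<^esub> w = \<zero>\<^bsub>J\<^esub>)"
proof -
  interpret R: cring R by fact
  interpret N: ideal N R by fact
  have lJ: "left_module R J" using J by (simp add: injective_module_def injective_over_def)
  interpret J: left_module R J by (rule lJ)
  let ?Y = "regular_module R"
  have Y: "left_module R ?Y" by (rule left_module_regular_module) unfold_locales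
  note Nc = N.Icarr
  \<comment> \<open>\<open>G\<close> is the graph of \<open>b p + n \<mapsto> p z\<close>; the
    essential point is that only zero lies over zero.\<close>
  define G where "G = {(b \<otimes>\<^bsub>R\<^esub> p \<oplus>\<^bsub>R\<^esub> n, p \<odot>\<^bsub>J\<^esub> z) | p n. p \<in> carrier R \<and> n \<in> N}"
  have GI: "(y, w) \<in> G"
    if "p \<in> carrier R" "n \<in> N" "y = b \<otimes>\<^bsub>R\<^esub> p \<oplus>\<^bsub>R\<^esub> n" "w = p \<odot>\<^bsub>J\<^esub> z" for p n y w
    using that unfolding G_def by blast
  have "partial_graph R ?Y J G"
    unfolding partial_graph_def
  proof (intro conjI allI impI)
    show "G \<subseteq> carrier ?Y \<times> carrier J"
      using b z Nc by (auto simp: G_def regular_module_def)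
  next
    fix y w y' w' assume "(y, w) \<in> G" "(y', w') \<in> G"
    then obtain p n p' n' where *: "p \<in> carrier R" "n \<in> N" "y = b \<otimes>\<^bsub>R\<^esub> p \<oplus>\<^bsub>R\<^esub> n" "w = p \<odot>\<^bsub>J\<^esub> z"
      "p' \<in> carrier R" "n' \<in> N" "y' = b \<otimes>\<^bsub>R\<^esub> p' \<oplus>\<^bsub>R\<^esub> n'" "w' = p' \<odot>\<^bsub>J\<^esub> z"
      unfolding G_def by blast
    show "(y \<oplus>\<^bsub>?Y\<^esub> y', w \<oplus>\<^bsub>J\<^esub> w') \<in> G"
      by (rule GI[of "p \<oplus>\<^bsub>R\<^esub> p'" "n \<oplus>\<^bsub>R\<^esub> n'"])
        (use * b z Nc[OF *(2)] Nc[OF *(6)] in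
          \<open>simp_all add: regular_module_def J.smult_l_distr R.r_distr R.a_ac J.M.a_ac\<close>)
  next
    fix r y w assume r: "r \<in> carrier R" and "(y, w) \<in> G"
    then obtain p n where *: "p \<in> carrier R" "n \<in> N" "y = b \<otimes>\<^bsub>R\<^esub> p \<oplus>\<^bsub>R\<^esub> n" "w = p \<odot>\<^bsub>J\<^esub> z"
      unfolding G_def by blast
    show "(r \<odot>\<^bsub>?Y\<^esub> y, r \<odot>\<^bsub>J\<^esub> w) \<in> G"
      by (rule GI[of "r \<otimes>\<^bsub>R\<^esub> p" "r \<otimes>\<^bsub>R\<^esub> n"])
        (use * b z r Nc[OF *(2)] in
          \<open>simp_all add: regular_module_def J.smult_assoc1 R.r_distr R.m_lcomm N.I_l_closed\<close>)
  next
    fix w assume "(\<zero>\<^bsub>?Y\<^esub>, w) \<in> G"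
    then obtain p n where *: "p \<in> carrier R" "n \<in> N" "\<zero>\<^bsub>R\<^esub> = b \<otimes>\<^bsub>R\<^esub> p \<oplus>\<^bsub>R\<^esub> n" "w = p \<odot>\<^bsub>J\<^esub> z"
      unfolding G_def by (auto simp: regular_module_def)
    then have "b \<otimes>\<^bsub>R\<^esub> p = \<ominus>\<^bsub>R\<^esub> n"
      using b Nc[OF *(2)] by (metis R.m_closed R.minus_equality)
    \<comment> \<open>Single-valuedness: \<open>b p\<close> lies in \<open>N\<close>, so
      \<open>p\<close> does by \<open>regular\<close>, and \<open>N\<close> kills
      \<open>z\<close>.\<close>
    then have "p \<in> N" using *(1,2) by (simp add: regular N.a_inv_closed)
    then show "w = \<zero>\<^bsub>J\<^esub>" using Nz *(4) by simp
  qed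
  moreover have bz: "(b, z) \<in> G"
    by (rule GI[of "\<one>\<^bsub>R\<^esub>" "\<zero>\<^bsub>R\<^esub>"]) (use b z in auto)
  moreover have nz: "(n, \<zero>\<^bsub>J\<^esub>) \<in> G" if "n \<in> N" for n
    by (rule GI[of "\<zero>\<^bsub>R\<^esub>" n]) (use b z that Nc in auto)
  \<comment> \<open>Extending the graph to the element \<open>\<one>\<close> yields
    \<open>w\<close>; the value over any \<open>p\<close> is then \<open>p w\<close>, read off at
    \<open>b\<close> and at the elements of \<open>N\<close>.\<close>
  ultimately obtain G' where G': "partial_graph R ?Y J G'" "G \<subseteq> G'" "\<one>\<^bsub>R\<^esub> \<in> fst ` G'"
    using partial_graph_step[OF J Y, of G "\<one>\<^bsub>R\<^esub>"] by (auto simp: regular_module_def)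
  then obtain w where w: "(\<one>\<^bsub>R\<^esub>, w) \<in> G'" by auto
  have un: "p \<odot>\<^bsub>J\<^esub> w = y" if "p \<in> carrier R" "(p, y) \<in> G'" for p y
  proof -
    have "(p \<odot>\<^bsub>?Y\<^esub> \<one>\<^bsub>R\<^esub>, p \<odot>\<^bsub>J\<^esub> w) \<in> G'"
      using G'(1) w that(1) unfolding partial_graph_def by blast
    then have "(p, p \<odot>\<^bsub>J\<^esub> w) \<in> G'" using that(1) by (simp add: regular_module_def)
    then show ?thesis using partial_graph_unique[OF G'(1) Y lJ] that(2) by blast
  qed
  have "w \<in> carrier J" using w G'(1) unfolding partial_graph_def by blast
  then show ?thesis using un bz nz G'(2) b Nc by blast
qed

section \<open>Ideals generated by variables\<close>

text \<open>The ideal generated by the variables in \<open>A\<close>, described monomial by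
  monomial: each monomial of \<open>p\<close> is divisible by some variable in
  \<open>A\<close>.\<close>

definition var_ideal :: "'a set \<Rightarrow> ('a, 'k::field) mpoly set" where
  "var_ideal A = {p. \<forall>m\<in>Poly_Mapping.keys p. \<exists>a\<in>A. Poly_Mapping.lookup m a \<noteq> 0}"

lemma ideal_var_ideal: "ideal (var_ideal A :: ('a, 'k::field) mpoly set) mpoly_ring"
proof -
  let ?R = "mpoly_ring :: ('a, 'k) mpoly ring"
  interpret R: cring ?R by (rule cring_mpoly_ring)
  have add: "p + q \<in> var_ideal A" if "p \<in> var_ideal A" "q \<in> var_ideal A" for p q :: "('a, 'k) mpoly"
    using that Poly_Mapping.keys_add[of p q] by (auto simp: var_ideal_def)
  \<comment> \<open>A monomial of \<open>p * q\<close> is a product whose factor from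
    \<open>q\<close> already contains a variable in \<open>A\<close>.\<close>
  have mult: "p * q \<in> var_ideal A" if q: "q \<in> var_ideal A" for p q :: "('a, 'k) mpoly"
    unfolding var_ideal_def
  proof (intro CollectI ballI)
    fix m assume "m \<in> Poly_Mapping.keys (p * q)"
    then obtain l l' where "m = l + l'" "l' \<in> Poly_Mapping.keys q" using keys_mult[of p q] by blast
    moreover from this obtain a where "a \<in> A" "Poly_Mapping.lookup l' a \<noteq> 0"
      using q by (auto simp: var_ideal_def)
    ultimately show "\<exists>a\<in>A. Poly_Mapping.lookup m a \<noteq> 0" by (auto simp: lookup_add)
  qed
  have neg: "\<ominus>\<^bsub>?R\<^esub> p = - p" for p
    by (rule R.minus_equality) (auto simp: mpoly_ring_def)
  show ?thesis
  proof (rule idealI)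
    show "subgroup (var_ideal A) (add_monoid ?R)"
    proof
      fix p :: "('a, 'k) mpoly" assume "p \<in> var_ideal A"
      then show "inv\<^bsub>add_monoid ?R\<^esub> p \<in> var_ideal A"
        using neg[of p] unfolding a_inv_def by (simp add: var_ideal_def keys_minus)
    qed (auto simp: mpoly_ring_def add, simp add: var_ideal_def)
  qed (use mult R.ring_axioms in \<open>auto simp: mpoly_ring_def mult.commute\<close>)
qed

text \<open>Multiplication by a variable shifts exponents and moves each coefficient
  unchanged.\<close>

lemma lookup_mpoly_var_mult:
  "Poly_Mapping.lookup (mpoly_var b * p) (Poly_Mapping.single b 1 + m) = Poly_Mapping.lookup p m"
  by (simp add: lookup_mult mpoly_var_def lookup_single when_mult)

text \<open>The variable \<open>b\<close> is regular modulo the ideal: if \<open>m\<close> is a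
  monomial of \<open>p\<close>, the shifted monomial contains a variable of \<open>A\<close>, which
  is not \<open>b\<close> and so occurs in \<open>m\<close>.\<close>

lemma var_ideal_regular:
  assumes "b \<notin> A" and p: "mpoly_var b * p \<in> var_ideal A"
  shows "p \<in> var_ideal A"
  unfolding var_ideal_def
proof (intro CollectI ballI)
  fix m assume "m \<in> Poly_Mapping.keys p"
  then have "Poly_Mapping.single b 1 + m \<in> Poly_Mapping.keys (mpoly_var b * p)"
    using lookup_mpoly_var_mult[of b p m] by (simp add: in_keys_iff)
  then obtain a where "a \<in> A" "Poly_Mapping.lookup (Poly_Mapping.single b 1 + m) a \<noteq> 0"
    using p unfolding var_ideal_def by blast
  then show "\<exists>a\<in>A. Poly_Mapping.lookup m a \<noteq> 0"
    using \<open>b \<notin> A\<close> by (auto simp: lookup_add lookup_single when_def split: if_splits)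
qed

text \<open>Induction adding one monomial at a time: each monomial is a multiple of a variable in
  \<open>A\<close>, which kills \<open>z\<close>.\<close>

lemma var_ideal_smult:
  assumes J: "left_module mpoly_ring J" and z: "z \<in> carrier J"
    and A: "\<And>a. a \<in> A \<Longrightarrow> mpoly_var a \<odot>\<^bsub>J\<^esub> z = \<zero>\<^bsub>J\<^esub>"
    and p: "p \<in> var_ideal A"
  shows "p \<odot>\<^bsub>J\<^esub> z = \<zero>\<^bsub>J\<^esub>"
  using p
proof (induction p rule: Poly_Mapping.update_induct)
  interpret J: left_module mpoly_ring J by fact
  case const
  show ?case using J.zero_smult[OF z] by (simp add: mpoly_ring_def)
next
  interpret J: left_module mpoly_ring J by fact
  case (update f m c)
  let ?s = "\<lambda>a. Poly_Mapping.single a (1::nat)"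
  have f: "f \<in> var_ideal A" and "\<exists>a\<in>A. Poly_Mapping.lookup m a \<noteq> 0"
    using update by (auto simp: var_ideal_def keys_update)
  then obtain a where a: "a \<in> A" "Poly_Mapping.lookup m a \<noteq> 0" by blast
  \<comment> \<open>Subtraction of exponents is truncated; it is undone here because
    \<open>a\<close> occurs in \<open>m\<close>.\<close>
  have m: "m - ?s a + ?s a = m"
    using a(2) by (intro poly_mapping_eqI) (auto simp: lookup_add lookup_minus lookup_single when_def)
  have "Poly_Mapping.update m c f = f + Poly_Mapping.single (m - ?s a) c * mpoly_var a"
    using update(1) m
    by (intro poly_mapping_eqI)
      (auto simp: mpoly_var_def mult_single lookup_add lookup_update lookup_single when_def
        in_keys_iff)
  then have "Poly_Mapping.update m c f =
      f \<oplus>\<^bsub>mpoly_ring\<^esub> Poly_Mapping.single (m - ?s a) c \<otimes>\<^bsub>mpoly_ring\<^esub> mpoly_var a"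
    by (simp add: mpoly_ring_def)
  moreover have "x \<in> carrier mpoly_ring" for x :: "('a, 'b) mpoly" by (simp add: mpoly_ring_def)
  ultimately show ?case
    using update(3)[OF f] A[OF a(1)] z by (simp add: J.smult_l_distr J.smult_assoc1)
qed

section \<open>Submodules annihilated by variables\<close>

text \<open>\<open>Hom(R/(A), J)\<close>, realised inside \<open>J\<close>. For
  \<open>A = {}\<close> the record is \<open>J\<close> itself.\<close>

definition var_torsion :: "'a set \<Rightarrow> (('a, 'k::field) mpoly, 'j) module \<Rightarrow> (('a, 'k) mpoly, 'j) module"
  where "var_torsion A J =
    J\<lparr>carrier := {z \<in> carrier J. \<forall>a\<in>A. mpoly_var a \<odot>\<^bsub>J\<^esub> z = \<zero>\<^bsub>J\<^esub>}\<rparr>"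

lemma left_module_var_torsion:
  assumes "left_module mpoly_ring J"
  shows "left_module mpoly_ring (var_torsion A J)"
proof -
  interpret J: left_module mpoly_ring J by fact
  have c: "x \<in> carrier mpoly_ring" for x by (simp add: mpoly_ring_def)
  have comm: "mpoly_var a \<odot>\<^bsub>J\<^esub> (r \<odot>\<^bsub>J\<^esub> x) = r \<odot>\<^bsub>J\<^esub> (mpoly_var a \<odot>\<^bsub>J\<^esub> x)" if "x \<in> carrier J" for a r x
    using that J.smult_assoc1[OF c c, of x "mpoly_var a" r] J.smult_assoc1[OF c c, of x r "mpoly_var a"]
    by (simp add: mpoly_ring_def mult.commute)
  show ?thesis
    unfolding var_torsion_def
    by (rule J.left_module_carrier_update) (auto simp: J.smult_r_distr c comm)
qed

text \<open>Divisibility applies to the ideal of \<open>A\<close>, modulo which \<open>b\<close> is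
  regular; a solution killed by that ideal is killed by its variables.\<close>

lemma var_torsion_divisible:
  assumes J: "injective_module mpoly_ring J" and "b \<notin> A" and z: "z \<in> carrier (var_torsion A J)"
  shows "\<exists>w\<in>carrier (var_torsion A J). mpoly_var b \<odot>\<^bsub>var_torsion A J\<^esub> w = z"
proof -
  have lJ: "left_module mpoly_ring J" using J by (simp add: injective_module_def injective_over_def)
  have z': "z \<in> carrier J" "\<And>a. a \<in> A \<Longrightarrow> mpoly_var a \<odot>\<^bsub>J\<^esub> z = \<zero>\<^bsub>J\<^esub>"
    using z by (auto simp: var_torsion_def)
  have "\<exists>w\<in>carrier J. mpoly_var b \<odot>\<^bsub>J\<^esub> w = z \<and> (\<forall>n\<in>var_ideal A. n \<odot>\<^bsub>J\<^esub> w = \<zero>\<^bsub>J\<^esub>)"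
    by (rule injective_module_divisible[OF cring_mpoly_ring J ideal_var_ideal _ _ z'(1)])
      (use var_ideal_regular[OF \<open>b \<notin> A\<close>] var_ideal_smult[OF lJ z'] in \<open>auto simp: mpoly_ring_def\<close>)
  moreover have "mpoly_var a \<in> var_ideal A" if "a \<in> A" for a
    using that by (auto simp: var_ideal_def mpoly_var_def intro!: bexI[of _ a])
  ultimately show ?thesis by (auto simp: var_torsion_def)
qed

lemma var_torsion_cocycles_bound:
  fixes J :: "(('a, 'k::field) mpoly, 'j) module"
  assumes inf: "infinite (UNIV :: 'a set)"
    and res: "injective_coresolution mpoly_ring (residue_module :: (('a, 'k) mpoly, 'k) module) \<epsilon> I d"
    and J: "injective_module mpoly_ring J" and "finite A"
  shows "cocycles_bound mpoly_ring I d n (var_torsion A J)"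
  using \<open>finite A\<close>
\<comment> \<open>Raising the degree by one costs one more annihilated variable, hence
  \<open>A\<close> is arbitrary; a fresh one always exists since the set of variables is
  infinite.\<close>
proof (induction n arbitrary: A)
  case (0 A)
  obtain b where "b \<notin> A" using ex_new_if_finite[OF inf 0] by blast
  show ?case
    by (rule cocycles_bound_0[OF res, of "mpoly_var b"])
      (use var_torsion_divisible[OF J \<open>b \<notin> A\<close>] residue_module_var[of b] in
        \<open>auto simp: mpoly_ring_def, auto simp: residue_module_def\<close>)
next
  case (Suc n A)
  have lJ: "left_module mpoly_ring J" using J by (simp add: injective_module_def injective_over_def)
  obtain b where "b \<notin> A" using ex_new_if_finite[OF inf Suc.prems] by blast
  show ?case
  proof (rule cocycles_bound_Suc[OF cring_mpoly_ring res])
    show "mpoly_var b \<odot>\<^bsub>residue_module\<^esub> c = \<zero>\<^bsub>residue_module\<^esub>" for c :: 'k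
      by (simp add: residue_module_var) (simp add: residue_module_def)
    show "left_module mpoly_ring (var_torsion A J)" "left_module mpoly_ring (var_torsion (insert b A) J)"
      by (rule left_module_var_torsion[OF lJ])+
    show "cocycles_bound mpoly_ring I d n (var_torsion (insert b A) J)"
      using Suc by simp
    show "var_torsion (insert b A) J = var_torsion A J\<lparr>carrier :=
        {x \<in> carrier (var_torsion A J). mpoly_var b \<odot>\<^bsub>var_torsion A J\<^esub> x = \<zero>\<^bsub>var_torsion A J\<^esub>}\<rparr>"
      unfolding var_torsion_def by (simp add: conj_ac)
  qed (use var_torsion_divisible[OF J \<open>b \<notin> A\<close>] in \<open>auto simp: mpoly_ring_def\<close>)
qed

section \<open>Modules of homomorphisms\<close>

lemma Hom_setD:
  assumes "f \<in> Hom_set R M N"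
  shows "f \<in> lmod_hom R M N" "x \<in> carrier M \<Longrightarrow> f x \<in> carrier N"
  using assms by (auto simp: Hom_set_def lmod_hom_def)

lemma Hom_set_eqI:
  assumes "f \<in> Hom_set R M N" "g \<in> Hom_set R M N" "\<And>x. x \<in> carrier M \<Longrightarrow> f x = g x"
  shows "f = g"
  using assms by (auto simp: Hom_set_def intro: extensionalityI)

lemma restrict_in_Hom_set:
  assumes "f \<in> lmod_hom R M N" "left_module R M"
  shows "restrict f (carrier M) \<in> Hom_set R M N"
proof -
  interpret left_module R M by fact
  show ?thesis using assms(1) by (auto simp: Hom_set_def lmod_hom_def)
qed

lemma compose_in_Hom_set:
  assumes "g \<in> lmod_hom R M N" "f \<in> Hom_set R L M" "left_module R L"
  shows "compose (carrier L) g f \<in> Hom_set R L N"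
  unfolding compose_def
  by (rule restrict_in_Hom_set[OF lmod_hom_comp[OF Hom_setD(1)[OF assms(2)] assms(1)] assms(3)])

text \<open>Stated for any record with these fields, so that it serves both \<open>End_op\<close>
  and \<open>Hom_module\<close>.\<close>

lemma abelian_group_Hom_set:
  assumes M: "left_module R M" and N: "left_module R N" and carrier: "carrier G = Hom_set R M N"
    and zero: "zero G = (\<lambda>x\<in>carrier M. \<zero>\<^bsub>N\<^esub>)"
    and add: "add G = (\<lambda>f g. \<lambda>x\<in>carrier M. f x \<oplus>\<^bsub>N\<^esub> g x)"
  shows "abelian_group G"
proof -
  interpret N: left_module R N by fact
  have plus: "(\<lambda>x\<in>carrier M. f x \<oplus>\<^bsub>N\<^esub> g x) \<in> Hom_set R M N"
    if "f \<in> Hom_set R M N" "g \<in> Hom_set R M N" for f g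
    by (intro restrict_in_Hom_set lmod_hom_closed_add Hom_setD(1) that M N)
  have zero': "(\<lambda>x\<in>carrier M. \<zero>\<^bsub>N\<^esub>) \<in> Hom_set R M N"
    by (intro restrict_in_Hom_set lmod_hom_const_zero M N)
  show ?thesis
  proof (rule abelian_groupI, goal_cases)
    case (3 f g h)
    then show ?case
      by (auto simp: carrier add Hom_setD N.M.a_assoc intro!: restrict_ext)
  next
    case (4 f g)
    then show ?case
      by (auto simp: carrier add Hom_setD N.M.a_comm intro!: restrict_ext)
  next
    case (5 f)
    then have f: "f \<in> Hom_set R M N" by (simp add: carrier)
    show ?case
      unfolding add zero by (rule Hom_set_eqI[OF plus[OF zero' f] f]) (simp add: Hom_setD[OF f])
  next
    case (6 f)
    then have f: "f \<in> lmod_hom R M N" by (simp add: carrier Hom_setD)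
    have "(\<lambda>x\<in>carrier M. \<ominus>\<^bsub>N\<^esub> f x) \<in> Hom_set R M N"
      by (intro restrict_in_Hom_set lmod_hom_closed_uminus f M N)
    moreover have "(\<lambda>x\<in>carrier M. \<ominus>\<^bsub>N\<^esub> f x) \<oplus>\<^bsub>G\<^esub> f = \<zero>\<^bsub>G\<^esub>"
      unfolding add zero by (rule restrict_ext) (simp add: lmod_homD[OF f] N.M.l_neg)
    ultimately show ?case unfolding carrier by blast
  qed (auto simp: carrier zero add plus zero')
qed

section \<open>The opposite endomorphism ring and its modules \<open>Hom(J, N)\<close>\<close>

lemma End_op_simps:
  "carrier (End_op R J) = Hom_set R J J"
  "\<zero>\<^bsub>End_op R J\<^esub> = (\<lambda>x\<in>carrier J. \<zero>\<^bsub>J\<^esub>)"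
  "\<one>\<^bsub>End_op R J\<^esub> = (\<lambda>x\<in>carrier J. x)"
  "s \<oplus>\<^bsub>End_op R J\<^esub> t = (\<lambda>x\<in>carrier J. s x \<oplus>\<^bsub>J\<^esub> t x)"
  "s \<otimes>\<^bsub>End_op R J\<^esub> t = compose (carrier J) t s"
  by (simp_all add: End_op_def)

lemma Hom_module_simps:
  "carrier (Hom_module R J N) = Hom_set R J N"
  "\<zero>\<^bsub>Hom_module R J N\<^esub> = (\<lambda>x\<in>carrier J. \<zero>\<^bsub>N\<^esub>)"
  "f \<oplus>\<^bsub>Hom_module R J N\<^esub> g = (\<lambda>x\<in>carrier J. f x \<oplus>\<^bsub>N\<^esub> g x)"
  "s \<odot>\<^bsub>Hom_module R J N\<^esub> f = compose (carrier J) f s"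
  by (simp_all add: Hom_module_def)

lemma ring_End_op:
  assumes J: "left_module R J"
  shows "ring (End_op R J)"
proof -
  interpret J: left_module R J by fact
  have id: "(\<lambda>x\<in>carrier J. x) \<in> Hom_set R J J"
    by (intro restrict_in_Hom_set lmod_hom_id J)
  have c: "compose (carrier J) t s \<in> Hom_set R J J"
    if "s \<in> Hom_set R J J" "t \<in> Hom_set R J J" for s t
    by (rule compose_in_Hom_set[OF Hom_setD(1)[OF that(2)] that(1) J])
  have ag: "abelian_group (End_op R J)"
    by (rule abelian_group_Hom_set[OF J J]) (auto simp: End_op_def)
  show ?thesis
  proof (rule ringI[OF ag], goal_cases)
    case 1
    show ?case
    proof (rule monoidI, goal_cases)
      case (4 f)
      then have f: "f \<in> Hom_set R J J" by (simp add: End_op_simps)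
      show ?case unfolding End_op_simps
        by (rule Hom_set_eqI[OF c[OF id f] f]) (simp add: compose_def)
    next
      case (5 f)
      then have f: "f \<in> Hom_set R J J" by (simp add: End_op_simps)
      show ?case unfolding End_op_simps
        by (rule Hom_set_eqI[OF c[OF f id] f]) (simp add: compose_def Hom_setD[OF f])
    qed (auto simp: End_op_simps c[unfolded compose_def] id compose_def Hom_setD intro!: restrict_ext)
  next
    \<comment> \<open>Products are composed in the opposite order, so this law needs additivity of
      \<open>h\<close>, whereas case 3 holds pointwise.\<close>
    case (2 f g h)
    then show ?case
      by (auto simp: End_op_simps compose_def Hom_setD lmod_homD[OF Hom_setD(1)[of h]] intro!: restrict_ext)
  next
    case (3 f g h)
    then show ?case
      by (auto simp: End_op_simps compose_def Hom_setD intro!: restrict_ext)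
  qed
qed

lemma left_module_Hom_module:
  assumes J: "left_module R J" and N: "left_module R N"
  shows "left_module (End_op R J) (Hom_module R J N)"
proof -
  interpret J: left_module R J by fact
  interpret N: left_module R N by fact
  interpret S: ring "End_op R J" by (rule ring_End_op[OF J])
  interpret H: abelian_group "Hom_module R J N"
    by (rule abelian_group_Hom_set[OF J N]) (auto simp: Hom_module_def)
  have c: "compose (carrier J) f s \<in> Hom_set R J N"
    if "s \<in> Hom_set R J J" "f \<in> Hom_set R J N" for s f
    by (rule compose_in_Hom_set[OF Hom_setD(1)[OF that(2)] that(1) J])
  show ?thesis
  proof (unfold_locales, goal_cases)
    case (2 s t f)
    then show ?case
      by (auto simp: End_op_simps Hom_module_simps compose_def Hom_setD
          lmod_homD[OF Hom_setD(1)[of f]] intro!: restrict_ext)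
  next
    case (5 f)
    then have f: "f \<in> Hom_set R J N" by (simp add: Hom_module_simps)
    have id: "(\<lambda>x\<in>carrier J. x) \<in> Hom_set R J J"
      by (intro restrict_in_Hom_set lmod_hom_id J)
    show ?case unfolding End_op_simps Hom_module_simps
      by (rule Hom_set_eqI[OF c[OF id f] f]) (simp add: compose_def)
  qed (auto simp: End_op_simps Hom_module_simps c[unfolded compose_def] compose_def Hom_setD intro!: restrict_ext)
qed

text \<open>Postcomposition with \<open>d\<close> commutes with precomposition by endomorphisms of
  \<open>J\<close>.\<close>

lemma Hom_module_hom:
  assumes J: "left_module R J" and N: "left_module R N" and d: "d \<in> lmod_hom R N N'"
  shows "compose (carrier J) d \<in> lmod_hom (End_op R J) (Hom_module R J N) (Hom_module R J N')"
proof -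
  interpret N: left_module R N by fact
  interpret J: left_module R J by fact
  show ?thesis
    unfolding lmod_hom_def
    by (auto simp: End_op_simps Hom_module_simps compose_in_Hom_set[OF d _ J])
      (auto simp: compose_def Hom_setD lmod_homD[OF d] intro!: restrict_ext)
qed

text \<open>If \<open>N\<close> is a retract of \<open>J\<close>, then \<open>Hom(J, N)\<close> is generated by the retraction \<open>p\<close>, since
  \<open>g = (i g) \<odot> p\<close>, and a homomorphism out of it is lifted by lifting the image of \<open>p\<close>.\<close>

lemma Hom_module_retract:
  fixes J :: "('r, 'j) module" and N :: "('r, 'n) module"
  assumes J: "left_module R J" and N: "left_module R N"
    and i: "i \<in> lmod_hom R N J" and p: "p \<in> lmod_hom R J N" and pi: "\<And>x. x \<in> carrier N \<Longrightarrow> p (i x) = x"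
  shows "finitely_generated (End_op R J) (Hom_module R J N)"
    and "projective_over TYPE('u) (End_op R J) (Hom_module R J N)"
proof -
  let ?S = "End_op R J" and ?H = "Hom_module R J N"
  have H: "left_module ?S ?H" by (rule left_module_Hom_module[OF J N])
  interpret H: left_module ?S ?H by (rule H)
  interpret J: left_module R J by fact
  define P where "P = restrict p (carrier J)"
  have P: "P \<in> carrier ?H"
    unfolding P_def Hom_module_simps by (rule restrict_in_Hom_set[OF p J])
  \<comment> \<open>\<open>L\<close> turns a homomorphism into \<open>N\<close> into an endomorphism
    of \<open>J\<close>, hence into a scalar of the ring.\<close>
  define L where "L = compose (carrier J) i"
  have L: "L \<in> lmod_hom ?S ?H (Hom_module R J J)"
    unfolding L_def by (rule Hom_module_hom[OF J N i])
  have LS: "L g \<in> carrier ?S" if "g \<in> carrier ?H" for g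
    using lmod_homD(1)[OF L that] by (simp add: Hom_module_simps End_op_simps)
  have LP: "L g \<odot>\<^bsub>?H\<^esub> P = g" if "g \<in> carrier ?H" for g
  proof (rule Hom_set_eqI)
    show "L g \<odot>\<^bsub>?H\<^esub> P \<in> Hom_set R J N"
      using H.smult_closed[OF LS[OF that] P] by (simp add: Hom_module_simps)
    show "g \<in> Hom_set R J N" using that by (simp add: Hom_module_simps)
    then show "(L g \<odot>\<^bsub>?H\<^esub> P) x = g x" if "x \<in> carrier J" for x
      using that pi lmod_homD(1)[OF i]
      by (simp add: Hom_module_simps compose_def L_def P_def Hom_setD)
  qed
  show "finitely_generated ?S ?H"
    unfolding finitely_generated_def
  proof (intro exI conjI ballI)
    fix g assume g: "g \<in> carrier ?H"
    have "(\<Oplus>\<^bsub>?H\<^esub>f\<in>{P}. L g \<odot>\<^bsub>?H\<^esub> f) = L g \<odot>\<^bsub>?H\<^esub> P"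
      using H.M.finsum_insert[of "{}" P "\<lambda>f. L g \<odot>\<^bsub>?H\<^esub> f"] H.smult_closed[OF LS[OF g] P] by simp
    then show "\<exists>c\<in>{P} \<rightarrow> carrier ?S. g = (\<Oplus>\<^bsub>?H\<^esub>f\<in>{P}. c f \<odot>\<^bsub>?H\<^esub> f)"
      using LP[OF g] LS[OF g] by (intro bexI[of _ "\<lambda>_. L g"]) auto
  qed (use P in auto)
  show "projective_over TYPE('u) ?S ?H"
    unfolding projective_over_def
  proof (intro conjI H allI impI, elim conjE)
    fix X Y :: "('j \<Rightarrow> 'j, 'u) module" and q f
    assume X: "left_module ?S X" and Y: "left_module ?S Y" and q: "q \<in> lmod_hom ?S X Y"
      and surj: "q ` carrier X = carrier Y" and f: "f \<in> lmod_hom ?S ?H Y"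
    interpret X: left_module ?S X by fact
    obtain x where x: "x \<in> carrier X" "q x = f P" using surj lmod_homD(1)[OF f P] by (metis imageE)
    have "(\<lambda>g. L g \<odot>\<^bsub>X\<^esub> x) \<in> lmod_hom ?S ?H X"
      unfolding lmod_hom_def
    proof (intro CollectI conjI ballI Pi_I)
      fix g h assume g: "g \<in> carrier ?H" and h: "h \<in> carrier ?H"
      show "L g \<odot>\<^bsub>X\<^esub> x \<in> carrier X" using LS[OF g] x by simp
      have "L (g \<oplus>\<^bsub>?H\<^esub> h) = L g \<oplus>\<^bsub>?S\<^esub> L h"
        using lmod_homD(2)[OF L g h] by (simp add: Hom_module_simps End_op_simps)
      then show "L (g \<oplus>\<^bsub>?H\<^esub> h) \<odot>\<^bsub>X\<^esub> x = L g \<odot>\<^bsub>X\<^esub> x \<oplus>\<^bsub>X\<^esub> L h \<odot>\<^bsub>X\<^esub> x"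
        using LS[OF g] LS[OF h] x by (simp add: X.smult_l_distr)
    next
      fix s g assume s: "s \<in> carrier ?S" and g: "g \<in> carrier ?H"
      \<comment> \<open>The action on \<open>Hom(J, J)\<close> by precomposition is the
        multiplication of the opposite ring, so linearity of \<open>L\<close> becomes compatibility
        with products.\<close>
      have "L (s \<odot>\<^bsub>?H\<^esub> g) = s \<otimes>\<^bsub>?S\<^esub> L g"
        using lmod_homD(3)[OF L s g] by (simp add: Hom_module_simps End_op_simps)
      then show "L (s \<odot>\<^bsub>?H\<^esub> g) \<odot>\<^bsub>X\<^esub> x = s \<odot>\<^bsub>X\<^esub> (L g \<odot>\<^bsub>X\<^esub> x)"
        using LS[OF g] s x by (simp add: X.smult_assoc1)
    qed
    \<comment> \<open>\<open>q (L g x) = L g (q x) = L g (f P) = f (L g P) = f g\<close>.\<close>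
    moreover have "q (L g \<odot>\<^bsub>X\<^esub> x) = f g" if g: "g \<in> carrier ?H" for g
      using lmod_homD(3)[OF q LS[OF g] x(1)] x(2) lmod_homD(3)[OF f LS[OF g] P] LP[OF g] by simp
    ultimately show "\<exists>g\<in>lmod_hom ?S ?H X. \<forall>y\<in>carrier ?H. q (g y) = f y"
      by (intro bexI[where x = "\<lambda>g. L g \<odot>\<^bsub>X\<^esub> x"] ballI)
  qed
qed

text \<open>Inclusion of the first factor and first projection, transported along the isomorphism
  \<open>f\<close>.\<close>

lemma direct_summand_retract:
  fixes R :: "('r, 'c) ring_scheme" and N :: "('r, 'n) module" and J :: "('r, 'j) module"
  assumes "direct_summand R N J"
  obtains i p where "i \<in> lmod_hom R N J" "p \<in> lmod_hom R J N" "\<And>x. x \<in> carrier N \<Longrightarrow> p (i x) = x"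
proof -
  obtain K :: "('r, 'j) module" and f where N: "left_module R N" and J: "left_module R J" and K: "left_module R K"
    and f: "f \<in> lmod_hom R (direct_sum_module N K) J"
    and bij: "bij_betw f (carrier N \<times> carrier K) (carrier J)"
    using assms unfolding direct_summand_def lmod_iso_def by (auto simp: direct_sum_module_def)
  interpret N: left_module R N by fact
  interpret J: left_module R J by fact
  interpret K: left_module R K by fact
  define e where "e = the_inv_into (carrier N \<times> carrier K) f"
  have ef: "e (f z) = z" if "z \<in> carrier N \<times> carrier K" for z
    unfolding e_def using that bij by (simp add: the_inv_into_f_f bij_betw_def)
  have fe: "\<exists>x\<in>carrier N. \<exists>k\<in>carrier K. y = f (x, k)" if "y \<in> carrier J" for y
  proof -
    have "y \<in> f ` (carrier N \<times> carrier K)" using that bij by (simp add: bij_betw_def)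
    then show ?thesis by blast
  qed
  have fadd: "f (x, k) \<oplus>\<^bsub>J\<^esub> f (x', k') = f (x \<oplus>\<^bsub>N\<^esub> x', k \<oplus>\<^bsub>K\<^esub> k')"
    if "x \<in> carrier N" "k \<in> carrier K" "x' \<in> carrier N" "k' \<in> carrier K" for x k x' k'
    using lmod_homD(2)[OF f, of "(x, k)" "(x', k')"] that by (simp add: direct_sum_module_def)
  have fsm: "r \<odot>\<^bsub>J\<^esub> f (x, k) = f (r \<odot>\<^bsub>N\<^esub> x, r \<odot>\<^bsub>K\<^esub> k)"
    if "x \<in> carrier N" "k \<in> carrier K" "r \<in> carrier R" for x k r
    using lmod_homD(3)[OF f, of r "(x, k)"] that by (simp add: direct_sum_module_def)
  have fc: "f (x, k) \<in> carrier J" if "x \<in> carrier N" "k \<in> carrier K" for x k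
    using lmod_homD(1)[OF f, of "(x, k)"] that by (simp add: direct_sum_module_def)
  show thesis
  proof (rule that)
    show "(\<lambda>x. f (x, \<zero>\<^bsub>K\<^esub>)) \<in> lmod_hom R N J"
      by (auto simp: lmod_hom_def fadd fsm fc)
    show "(\<lambda>y. fst (e y)) \<in> lmod_hom R J N"
      unfolding lmod_hom_def
    proof (intro CollectI conjI ballI Pi_I)
      fix y y' assume "y \<in> carrier J" "y' \<in> carrier J"
      then obtain x k x' k' where "x \<in> carrier N" "k \<in> carrier K" "y = f (x, k)"
        "x' \<in> carrier N" "k' \<in> carrier K" "y' = f (x', k')" using fe by metis
      then show "fst (e y) \<in> carrier N" "fst (e (y \<oplus>\<^bsub>J\<^esub> y')) = fst (e y) \<oplus>\<^bsub>N\<^esub> fst (e y')"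
        by (simp_all add: fadd ef)
    next
      fix r y assume "r \<in> carrier R" "y \<in> carrier J"
      moreover from this obtain x k where "x \<in> carrier N" "k \<in> carrier K" "y = f (x, k)"
        using fe by metis
      ultimately show "fst (e (r \<odot>\<^bsub>J\<^esub> y)) = r \<odot>\<^bsub>N\<^esub> fst (e y)" by (simp add: fsm ef)
    qed
    show "fst (e (f (x, \<zero>\<^bsub>K\<^esub>))) = x" if "x \<in> carrier N" for x
      using that by (simp add: ef)
  qed
qed

lemma left_module_zero_module:
  assumes "ring R"
  shows "left_module R (zero_module :: ('r, 'm) module)"
proof -
  interpret ring R by fact
  show ?thesis
    by unfold_locales (auto simp: zero_module_def Units_def)
qed

section \<open>Complexes and the functor \<open>Hom(J, -)\<close>\<close>

lemma Hom_complex_simps: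
  "cterm (Hom_complex R J C) n = Hom_module R J (cterm C n)"
  "cdiff (Hom_complex R J C) n = compose (carrier J) (cdiff C n)"
  by (simp_all add: Hom_complex_def)

lemma cochain_complex_Hom_complex:
  assumes J: "left_module R J" and C: "cochain_complex R C"
  shows "cochain_complex (End_op R J) (Hom_complex R J C)"
proof -
  interpret J: left_module R J by fact
  have T: "left_module R (cterm C n)"
    and d: "cdiff C n \<in> lmod_hom R (cterm C n) (cterm C (n + 1))"
    and dd: "\<forall>x\<in>carrier (cterm C n). cdiff C (n + 1) (cdiff C n x) = \<zero>\<^bsub>cterm C (n + 2)\<^esub>" for n
    using C by (auto simp: cochain_complex_def)
  show ?thesis
    unfolding cochain_complex_def Hom_complex_simps
    by (intro conjI allI ballI left_module_Hom_module Hom_module_hom J T d)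
      (auto simp: Hom_module_simps compose_def dd Hom_setD intro!: restrict_ext)
qed

lemma cochain_complex_nonneg_complex:
  fixes I :: "nat \<Rightarrow> ('r, 'm) module"
  assumes R: "ring R" and res: "injective_coresolution R M \<epsilon> I d"
  shows "cochain_complex R (nonneg_complex I d)"
proof -
  note D = coresolutionD[OF res]
  let ?C = "nonneg_complex I d"
  have "left_module R (zero_module :: ('r, 'm) module)" by (rule left_module_zero_module[OF R])
  then have T: "left_module R (cterm ?C n)" for n
    using D(3) by (simp add: nonneg_complex_def Let_def)
  have d: "cdiff ?C n \<in> lmod_hom R (cterm ?C n) (cterm ?C (n + 1))" for n
  proof (cases "n < 0")
    case True
    then have "cdiff ?C n = (\<lambda>_. \<zero>\<^bsub>cterm ?C (n + 1)\<^esub>)"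
      by (simp add: nonneg_complex_def Let_def)
    then show ?thesis using lmod_hom_const_zero[OF T] by simp
  next
    case False
    then show ?thesis using D(5)[of "nat n"] by (simp add: nonneg_complex_def Let_def nat_add_distrib)
  qed
  have "cdiff ?C (n + 1) (cdiff ?C n x) = \<zero>\<^bsub>cterm ?C (n + 2)\<^esub>" if "x \<in> carrier (cterm ?C n)" for n x
  proof (cases "n < 0")
    case True
    then have "cdiff ?C n x = \<zero>\<^bsub>cterm ?C (n + 1)\<^esub>" by (simp add: nonneg_complex_def Let_def)
    \<comment> \<open>For \<open>n = -1\<close> the second differential is \<open>d 0\<close>, which
      sends zero to zero by linearity.\<close>
    then show ?thesis using lmod_hom_zero[OF d T T, of "n + 1"] by (simp add: add.assoc)
  next
    case False
    then have "nat (n + 1) = Suc (nat n)" "nat (n + 2) = Suc (Suc (nat n))" by auto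
    then show ?thesis using that False D(8)[of x "nat n"] by (simp add: nonneg_complex_def Let_def)
  qed
  then show ?thesis using T d by (simp add: cochain_complex_def)
qed

section \<open>The complex of homomorphisms\<close>

text \<open>Elements of the Hom complex are cochains on \<open>J\<close>, so exactness in degrees
  \<open>n >= 0\<close> is the bound on cocycles; terms in negative degrees vanish.\<close>

lemma acyclic_Hom_nonneg_complex:
  assumes R: "ring R" and J: "left_module R J" and res: "injective_coresolution R M \<epsilon> I d"
    and bound: "\<And>n. cocycles_bound R I d n J"
  shows "acyclic_complex (Hom_complex R J (nonneg_complex I d))"
  unfolding acyclic_complex_def
proof (intro allI equalityI subsetI)
  let ?C = "nonneg_complex I d"
  let ?H = "Hom_complex R J ?C"
  have C: "cochain_complex R ?C" by (rule cochain_complex_nonneg_complex[OF R res])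
  have H: "cochain_complex (End_op R J) ?H" by (rule cochain_complex_Hom_complex[OF J C])
  then have lH: "left_module (End_op R J) (cterm ?H n)"
    and dH: "cdiff ?H n \<in> lmod_hom (End_op R J) (cterm ?H n) (cterm ?H (n + 1))"
    and ddH: "x \<in> carrier (cterm ?H n) \<Longrightarrow> cdiff ?H (n + 1) (cdiff ?H n x) = \<zero>\<^bsub>cterm ?H (n + 2)\<^esub>" for n x
    by (auto simp: cochain_complex_def)
  have lC: "left_module R (cterm ?C n)" for n using C by (simp add: cochain_complex_def)
  fix n :: int and f
  show "f \<in> a_kernel (cterm ?H n) (cterm ?H (n + 1)) (cdiff ?H n)"
    if "f \<in> cdiff ?H (n - 1) ` carrier (cterm ?H (n - 1))"
    using that ddH[of _ "n - 1"] lmod_homD(1)[OF dH[of "n - 1"]]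
    by (auto simp: a_kernel_def' algebra_simps)
  assume "f \<in> a_kernel (cterm ?H n) (cterm ?H (n + 1)) (cdiff ?H n)"
  then have fH: "f \<in> Hom_set R J (cterm ?C n)"
    and cf: "compose (carrier J) (cdiff ?C n) f = (\<lambda>x\<in>carrier J. \<zero>\<^bsub>cterm ?C (n + 1)\<^esub>)"
    by (simp_all add: a_kernel_def' Hom_complex_simps Hom_module_simps)
  have df: "cdiff ?C n (f x) = \<zero>\<^bsub>cterm ?C (n + 1)\<^esub>" if "x \<in> carrier J" for x
    using fun_cong[OF cf, of x] that by (simp add: compose_def)
  \<comment> \<open>In degrees \<open>n <= 0\<close> the previous term is zero, so a cocycle must be
    shown to vanish.\<close>
  have zero: "f \<in> cdiff ?H (n - 1) ` carrier (cterm ?H (n - 1))"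
    if "\<And>x. x \<in> carrier J \<Longrightarrow> f x = \<zero>\<^bsub>cterm ?C n\<^esub>"
  proof -
    interpret L: left_module "End_op R J" "cterm ?H (n - 1)" by (rule lH)
    have "f = \<zero>\<^bsub>cterm ?H n\<^esub>"
      unfolding Hom_complex_simps Hom_module_simps
      by (rule Hom_set_eqI[OF fH restrict_in_Hom_set[OF lmod_hom_const_zero[OF lC] J]])
        (simp add: that)
    also have "\<dots> = cdiff ?H (n - 1) \<zero>\<^bsub>cterm ?H (n - 1)\<^esub>"
      using lmod_hom_zero[OF dH lH lH, of "n - 1"] by simp
    finally show ?thesis by blast
  qed
  consider "n < 0" | "n = 0" | k where "n = int (Suc k)"
    by (metis gr0_implies_Suc zero_less_imp_eq_int linorder_less_linear)
  then show "f \<in> cdiff ?H (n - 1) ` carrier (cterm ?H (n - 1))"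
  proof cases
    case 1
    show ?thesis
      by (rule zero) (use Hom_setD(2)[OF fH] 1 in \<open>simp add: nonneg_complex_def zero_module_def Let_def\<close>)
  next
    case 2
    show ?thesis
      by (rule zero) (use Hom_setD(1)[OF fH] df bound[of 0] 2 in
          \<open>simp add: nonneg_complex_def Let_def cocycles_bound_def\<close>)
  next
    case (3 k)
    have C': "cterm ?C n = I (Suc k)" "cterm ?C (n + 1) = I (Suc (Suc k))" "cterm ?C (n - 1) = I k"
      "cdiff ?C n = d (Suc k)" "cdiff ?C (n - 1) = d k"
      using 3 by (simp_all add: nonneg_complex_def Let_def nat_add_distrib)
    obtain g where g: "g \<in> lmod_hom R J (I k)" "\<forall>x\<in>carrier J. f x = d k (g x)"
      using bound[of "Suc k"] Hom_setD(1)[OF fH] df by (auto simp: C' cocycles_bound_def)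
    \<comment> \<open>\<open>g\<close> may take arbitrary values off \<open>carrier J\<close>; its
      restriction is an element of the Hom module.\<close>
    have g': "restrict g (carrier J) \<in> carrier (cterm ?H (n - 1))"
      unfolding Hom_complex_simps Hom_module_simps C' by (rule restrict_in_Hom_set[OF g(1) J])
    then have "cdiff ?H (n - 1) (restrict g (carrier J)) \<in> Hom_set R J (cterm ?C n)"
      using lmod_homD(1)[OF dH[of "n - 1"]] by (simp add: Hom_complex_simps Hom_module_simps)
    then have "f = cdiff ?H (n - 1) (restrict g (carrier J))"
      using fH g(2) by (intro Hom_set_eqI) (auto simp: Hom_complex_simps C' compose_def)
    then show ?thesis using g' by blast
  qed
qed

text \<open>A contraction \<open>h\<close> is a natural transformation on the summands of \<open>J\<close>, so by Yoneda it is
  composition with \<open>s = h\<^sub>1(p) \<circ> i\<close>, where \<open>i\<close> and \<open>p\<close> exhibit \<open>I 1\<close> as a retract of \<open>J\<close>.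
  Then \<open>s \<circ> d\<close> is the identity on \<open>I 0\<close>, although \<open>d\<close> kills the image of \<open>\<epsilon>\<close>.\<close>

lemma not_contractible_Hom_nonneg_complex:
  assumes R: "ring R" and J: "left_module R J" and res: "injective_coresolution R M \<epsilon> I d"
    and summand: "\<And>n. direct_summand R (I n) J" and M: "carrier M \<noteq> {\<zero>\<^bsub>M\<^esub>}"
  shows "\<not> contractible (End_op R J) (Hom_complex R J (nonneg_complex I d))"
proof
  let ?C = "nonneg_complex I d"
  let ?H = "Hom_complex R J ?C"
  note D = coresolutionD[OF res]
  interpret M: left_module R M by (rule D)
  interpret I0: left_module R "I 0" by (rule D)
  have C: "cochain_complex R ?C" by (rule cochain_complex_nonneg_complex[OF R res])
  have T: "cterm ?C 0 = I 0" "cterm ?C 1 = I 1" "cdiff ?C 0 = d 0"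
    "cdiff ?C (- 1) = (\<lambda>_. \<zero>\<^bsub>I 0\<^esub>)"
    by (simp_all add: nonneg_complex_def Let_def)
  assume "contractible (End_op R J) ?H"
  then obtain h where h: "\<And>n. h n \<in> lmod_hom (End_op R J) (cterm ?H n) (cterm ?H (n - 1))"
    and hd: "\<And>n f. f \<in> carrier (cterm ?H n) \<Longrightarrow> f \<ominus>\<^bsub>cterm ?H n\<^esub> \<zero>\<^bsub>cterm ?H n\<^esub> =
      cdiff ?H (n - 1) (h n f) \<oplus>\<^bsub>cterm ?H n\<^esub> h (n + 1) (cdiff ?H n f)"
    unfolding contractible_def homotopic_def by blast
  obtain i p where i: "i \<in> lmod_hom R (I 1) J" and p: "p \<in> lmod_hom R J (I 1)"
    and pi: "\<And>x. x \<in> carrier (I 1) \<Longrightarrow> p (i x) = x"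
    using direct_summand_retract[OF summand[of 1]] by blast
  obtain j q where j: "j \<in> lmod_hom R (I 0) J" and q: "q \<in> lmod_hom R J (I 0)"
    and qj: "\<And>x. x \<in> carrier (I 0) \<Longrightarrow> q (j x) = x"
    using direct_summand_retract[OF summand[of 0]] by blast
  define P where "P = restrict p (carrier J)"
  define Q where "Q = restrict q (carrier J)"
  have P: "P \<in> Hom_set R J (I 1)" unfolding P_def by (rule restrict_in_Hom_set[OF p J])
  have Q: "Q \<in> Hom_set R J (I 0)" unfolding Q_def by (rule restrict_in_Hom_set[OF q J])
  have h1: "h 1 \<in> lmod_hom (End_op R J) (Hom_module R J (I 1)) (Hom_module R J (I 0))"
    using h[of 1] by (simp add: Hom_complex_simps T)
  define dQ where "dQ = compose (carrier J) (d 0) Q"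
  have dQ: "dQ \<in> Hom_set R J (I 1)"
    unfolding dQ_def using compose_in_Hom_set[OF D(5) Q J] by simp
  have hQ: "h 0 Q \<in> Hom_set R J (cterm ?C (- 1))"
    using lmod_homD(1)[OF h[of 0], of Q] Q by (simp add: Hom_complex_simps Hom_module_simps T)
  have hdQ: "h 1 dQ \<in> Hom_set R J (I 0)"
    using lmod_homD(1)[OF h1, of dQ] dQ by (simp add: Hom_module_simps)
  let ?H0 = "Hom_module R J (I 0)"
  interpret H0: left_module "End_op R J" ?H0 by (rule left_module_Hom_module[OF J D(3)])
  have QH: "Q \<in> carrier ?H0" "h 1 dQ \<in> carrier ?H0" using Q hdQ by (simp_all add: Hom_module_simps)
  \<comment> \<open>The homotopy identity at \<open>Q\<close> in degree 0 gives
    \<open>h 1 dQ = Q\<close>, as the incoming differential is zero.\<close>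
  have "Q \<ominus>\<^bsub>?H0\<^esub> \<zero>\<^bsub>?H0\<^esub> = (\<lambda>x\<in>carrier J. \<zero>\<^bsub>I 0\<^esub>) \<oplus>\<^bsub>?H0\<^esub> h 1 dQ"
    using hd[of Q 0] Q by (simp add: Hom_complex_simps T dQ_def compose_def Hom_module_simps(1))
  also have "\<dots> = \<zero>\<^bsub>?H0\<^esub> \<oplus>\<^bsub>?H0\<^esub> h 1 dQ" by (simp only: Hom_module_simps(2))
  also have "\<dots> = h 1 dQ" using QH by simp
  finally have hdQ_eq: "h 1 dQ = Q"
    using QH H0.M.minus_equality[of "\<zero>\<^bsub>?H0\<^esub>" "\<zero>\<^bsub>?H0\<^esub>"] by (simp add: a_minus_def)
  \<comment> \<open>The endomorphism \<open>s\<close> of \<open>J\<close> factors \<open>dQ\<close>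
    as \<open>P\<close> after \<open>s\<close>, that is \<open>s \<odot> P = dQ\<close>; linearity
    of \<open>h 1\<close> over the ring then gives \<open>h 1 dQ\<close> as \<open>h 1 P\<close>
    after \<open>s\<close>.\<close>
  define s where "s = compose (carrier J) i dQ"
  have s: "s \<in> Hom_set R J J" unfolding s_def by (rule compose_in_Hom_set[OF i dQ J])
  have sP: "compose (carrier J) P s = dQ"
  proof (rule Hom_set_eqI[OF compose_in_Hom_set[OF Hom_setD(1)[OF P] s J] dQ])
    show "compose (carrier J) P s x = dQ x" if "x \<in> carrier J" for x
      using that Hom_setD(2)[OF dQ that] lmod_homD(1)[OF i] pi by (simp add: compose_def P_def s_def)
  qed
  have hP: "h 1 P \<in> Hom_set R J (I 0)"
    using lmod_homD(1)[OF h1, of P] P by (simp add: Hom_module_simps)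
  have "compose (carrier J) (h 1 P) s = Q"
    using lmod_homD(3)[OF h1, of s P] s P sP hdQ_eq by (simp add: Hom_module_simps End_op_simps)
  \<comment> \<open>Evaluate at \<open>j y\<close>, where \<open>Q\<close> takes the value
    \<open>y\<close>.\<close>
  then have eq: "h 1 P (i (d 0 y)) = y" if "y \<in> carrier (I 0)" for y
    using that lmod_homD(1)[OF j that] qj[OF that]
    by (auto simp: compose_def s_def dQ_def Q_def fun_eq_iff dest!: spec[of _ "j y"])
  have "m = \<zero>\<^bsub>M\<^esub>" if m: "m \<in> carrier M" for m
  proof -
    have e: "\<epsilon> m \<in> carrier (I 0)" using lmod_homD(1)[OF D(4) m] .
    \<comment> \<open>Exactness gives \<open>d 0 (\<epsilon> m) = 0\<close>, so by \<open>eq\<close>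
      the element \<open>\<epsilon> m\<close> is the image of zero.\<close>
    have "\<epsilon> m = h 1 P (i \<zero>\<^bsub>I 1\<^esub>)" using eq[OF e] D(6)[OF m] by simp
    also have "\<dots> = \<epsilon> \<zero>\<^bsub>M\<^esub>"
      using lmod_hom_zero[OF i D(3) J] lmod_hom_zero[OF Hom_setD(1)[OF hP] J D(3)]
        lmod_hom_zero[OF D(4) D(1) D(3)] by simp
    finally show ?thesis
      using res m unfolding injective_coresolution_def by (auto dest: inj_onD)
  qed
  then show False using M by blast
qed

lemma Hom_set_zero_module: "Hom_set R J zero_module = {\<lambda>x\<in>carrier J. \<zero>\<^bsub>zero_module\<^esub>}"
  by (auto simp: Hom_set_def lmod_hom_def zero_module_def Pi_iff intro!: extensionalityI)

lemma bounded_below_Hom_nonneg_complex: "bounded_below (Hom_complex R J (nonneg_complex I d))"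
  unfolding bounded_below_def
  by (intro exI[of _ 0])
    (simp add: Hom_complex_simps Hom_module_simps nonneg_complex_def Let_def Hom_set_zero_module)

theorem corollary2p3:
  fixes \<epsilon> :: "'k::field \<Rightarrow> 'm"
    and I :: "nat \<Rightarrow> (('a, 'k) mpoly, 'm) module"
    and d :: "nat \<Rightarrow> 'm \<Rightarrow> 'm"
    and J :: "(('a, 'k) mpoly, 'j) module"
  assumes "infinite (UNIV :: 'a set)"
    and "injective_coresolution mpoly_ring residue_module \<epsilon> I d"
    and "injective_module mpoly_ring J"
    and "\<forall>n. direct_summand mpoly_ring (I n) J"
  shows "let S = End_op mpoly_ring J;
             C = Hom_complex mpoly_ring J (nonneg_complex I d)
         in ring S \<and>
            cochain_complex S C \<and>
            bounded_below C \<and>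
            \<not> contractible S C \<and>
            acyclic_complex C \<and>
            (\<forall>n. finitely_generated S (cterm C n) \<and>
                 projective_over TYPE('u) S (cterm C n))"
proof -
  let ?R = "mpoly_ring :: ('a, 'k) mpoly ring"
  let ?C = "nonneg_complex I d"
  have R: "ring ?R" using cring_mpoly_ring by (rule cring.axioms(1))
  have J: "left_module ?R J"
    using assms(3) by (simp add: injective_module_def injective_over_def)
  interpret J: left_module ?R J by (rule J)
  have C: "cochain_complex ?R ?C" by (rule cochain_complex_nonneg_complex[OF R assms(2)])
  \<comment> \<open>The empty set of variables imposes no condition, so its torsion submodule is
    \<open>J\<close>.\<close>
  have bound: "cocycles_bound ?R I d n J" for n
    using var_torsion_cocycles_bound[OF assms(1-3), of "{}" n] by (simp add: var_torsion_def)
  have nontrivial: "carrier (residue_module :: (('a, 'k) mpoly, 'k) module) \<noteq> {\<zero>\<^bsub>residue_module\<^esub>}"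
    by (simp add: residue_module_def) (metis UNIV_I singletonD zero_neq_one)
  \<comment> \<open>Every term, including the zero modules in negative degrees, is a retract of
    \<open>J\<close>, so finite generation and projectivity follow in all degrees at once.\<close>
  have "\<exists>i p. i \<in> lmod_hom ?R (cterm ?C n) J \<and> p \<in> lmod_hom ?R J (cterm ?C n) \<and>
      (\<forall>x\<in>carrier (cterm ?C n). p (i x) = x)" for n
  proof (cases "n < 0")
    case True
    then have "cterm ?C n = zero_module" by (simp add: nonneg_complex_def Let_def)
    then show ?thesis
      \<comment> \<open>\<open>undefined\<close> is the only element of
        \<open>zero_module\<close>.\<close>
      by (intro exI[of _ "\<lambda>_. \<zero>\<^bsub>J\<^esub>"] exI[of _ "\<lambda>_. undefined"])
        (simp add: lmod_hom_def zero_module_def)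
  next
    case False
    then have "cterm ?C n = I (nat n)" by (simp add: nonneg_complex_def Let_def)
    then show ?thesis using direct_summand_retract[of ?R "I (nat n)" J] assms(4) by metis
  qed
  then have "finitely_generated (End_op ?R J) (Hom_module ?R J (cterm ?C n)) \<and>
      projective_over TYPE('u) (End_op ?R J) (Hom_module ?R J (cterm ?C n))" for n
    using Hom_module_retract[OF J, of "cterm ?C n"] C unfolding cochain_complex_def by metis
  then show ?thesis
    using ring_End_op[OF J] cochain_complex_Hom_complex[OF J C] bounded_below_Hom_nonneg_complex
      not_contractible_Hom_nonneg_complex[OF R J assms(2) _ nontrivial] assms(4)
      acyclic_Hom_nonneg_complex[OF R J assms(2) bound]
    by (simp add: Hom_complex_simps)
qed

end
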